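(* \textsc{$\alpha$-Globally Optimal Assignment} is solvable in time $(nm)^{\mathcal{O}(m)}$, where $n$ is the number of agents and $m$ the number of items.
   Context: An instance of \textsc{$\alpha$-Globally Optimal Assignment} is a tuple $(A,I,P_1,\ldots,P_\ell,\alpha)$ where $A$ is a set of $n$ agents, $I$ is a set of $m$ items, $\alpha\in\{1,\ldots,\ell\}$, and for each layer $j\in\{1,\ldots,\ell\}$ the preference profile $P_j$ assigns to every agent $a$ a preference list $<^{(j)}_a$, which is a strict linear order over a subset of $I$ (the items acceptable to $a$ in layer $j$; lists may be incomplete). A special item $b_\emptyset\notin I$ is regarded as the least preferred item of every agent. An assignment is a map $p:A\to I\cup\{b_\emptyset\}$ such that no item of $I$ is assigned to two different agents; it is legal in layer $j$ if every agent receives either $b_\emptyset$ or an item acceptable to it in layer $j$. A legal assignment $p$ is Pareto optimal in layer $j$ if there is no other legal assignment $q$ (for layer $j$) with $p(a)\le^{(j)}_a q(a)$ for all $a\in A$ and $p(a)<^{(j)}_a q(a)$ for some $a\in A$. An assignment is $\alpha$-globally optimal if there exist $\alpha$ distinct layers in each of which it is Pareto optimal. The problem asks whether an $\alpha$-globally optimal assignment exists.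
   Formalization: The time bound proved is (nm)^{O(m)} times a constant and a linear factor ℓ (number of layers), with nm replaced by 1 when it is 0; without dependence on ℓ the claim fails, e.g. for n = m = 1 and α = ℓ, where all layers must be read. *)

theory Defs
  imports Main
begin

section \<open>Globally optimal assignments\<close>

text \<open>
  Layers are numbered \<open>1, \<dots>, layers inst\<close>. In layer \<open>j\<close>, agent \<open>a\<close> orders the set
  \<open>acceptable inst j a\<close> by \<open>pref inst j a\<close>, where \<open>(x, y) \<in> pref inst j a\<close> means that
  \<open>a\<close> strictly prefers \<open>y\<close> to \<open>x\<close>. The acceptable set is kept separately because the relation
  alone does not distinguish an empty preference list from a list with one item.
\<close>

record ('a, 'i) goa =
  agents :: "'a set"
  items :: "'i set"
  layers :: nat
  alpha :: nat
  acceptable :: "nat \<Rightarrow> 'a \<Rightarrow> 'i set"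
  pref :: "nat \<Rightarrow> 'a \<Rightarrow> ('i \<times> 'i) set"

definition goa_instance :: "('a, 'i) goa \<Rightarrow> bool" where
  "goa_instance inst \<longleftrightarrow>
     finite (agents inst) \<and> finite (items inst) \<and> alpha inst \<in> {1..layers inst} \<and>
     (\<forall>j\<in>{1..layers inst}. \<forall>a\<in>agents inst.
        acceptable inst j a \<subseteq> items inst \<and>
        pref inst j a \<subseteq> acceptable inst j a \<times> acceptable inst j a \<and>
        strict_linear_order_on (acceptable inst j a) (pref inst j a))"

text \<open>\<open>None\<close> plays the role of the special item \<open>b\<^sub>\<emptyset>\<close>, the least preferred one.\<close>

fun prefers :: "('a, 'i) goa \<Rightarrow> nat \<Rightarrow> 'a \<Rightarrow> 'i option \<Rightarrow> 'i option \<Rightarrow> bool" where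
  "prefers inst j a (Some x) (Some y) \<longleftrightarrow> (x, y) \<in> pref inst j a"
| "prefers inst j a None (Some y) \<longleftrightarrow> y \<in> acceptable inst j a"
| "prefers inst j a _ None \<longleftrightarrow> False"

definition weakly_prefers ::
    "('a, 'i) goa \<Rightarrow> nat \<Rightarrow> 'a \<Rightarrow> 'i option \<Rightarrow> 'i option \<Rightarrow> bool" where
  "weakly_prefers inst j a x y \<longleftrightarrow> x = y \<or> prefers inst j a x y"

text \<open>
  An assignment is a total function of which only the values on \<open>agents inst\<close> matter; all notions
  below ignore the other values.
\<close>

definition assignment :: "('a, 'i) goa \<Rightarrow> ('a \<Rightarrow> 'i option) \<Rightarrow> bool" where
  "assignment inst p \<longleftrightarrow>
     (\<forall>a\<in>agents inst. p a \<in> insert None (Some ` items inst)) \<and>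
     (\<forall>a\<in>agents inst. \<forall>b\<in>agents inst. a \<noteq> b \<longrightarrow> p a = p b \<longrightarrow> p a = None)"

definition legal :: "('a, 'i) goa \<Rightarrow> nat \<Rightarrow> ('a \<Rightarrow> 'i option) \<Rightarrow> bool" where
  "legal inst j p \<longleftrightarrow> assignment inst p \<and>
     (\<forall>a\<in>agents inst. p a \<in> insert None (Some ` acceptable inst j a))"

definition pareto_optimal :: "('a, 'i) goa \<Rightarrow> nat \<Rightarrow> ('a \<Rightarrow> 'i option) \<Rightarrow> bool" where
  "pareto_optimal inst j p \<longleftrightarrow> legal inst j p \<and>
     \<not> (\<exists>q. legal inst j q \<and>
          (\<forall>a\<in>agents inst. weakly_prefers inst j a (p a) (q a)) \<and>
          (\<exists>a\<in>agents inst. prefers inst j a (p a) (q a)))"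

definition globally_optimal :: "('a, 'i) goa \<Rightarrow> ('a \<Rightarrow> 'i option) \<Rightarrow> bool" where
  "globally_optimal inst p \<longleftrightarrow> assignment inst p \<and>
     (\<exists>J. J \<subseteq> {1..layers inst} \<and> card J = alpha inst \<and> (\<forall>j\<in>J. pareto_optimal inst j p))"

definition goa_yes :: "('a, 'i) goa \<Rightarrow> bool" where
  "goa_yes inst \<longleftrightarrow> (\<exists>p. globally_optimal inst p)"


section \<open>Random access machine programs with unit cost\<close>

text \<open>
  The machine has registers and a random access memory, both holding natural numbers. Only addition
  and truncated subtraction are unit-cost arithmetic operations (no multiplication), so that a
  number gains at most one bit per step and running times are polynomially related to those of
  Turing machines. Control flow is structured; such programs compile to jumps with constant-factor
  overhead.
\<close>

datatype com =
    Const nat nat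
  | Add nat nat nat
  | Sub nat nat nat
  | Load nat nat
  | Store nat nat
  | Seq com com
  | IfLess nat nat com com
  | WhileLess nat nat com

type_synonym state = "(nat \<Rightarrow> nat) \<times> (nat \<Rightarrow> nat)"

text \<open>\<open>exec c s t s'\<close>: started in state \<open>s\<close>, the program \<open>c\<close> halts after \<open>t\<close> steps in state \<open>s'\<close>.\<close>

inductive exec :: "com \<Rightarrow> state \<Rightarrow> nat \<Rightarrow> state \<Rightarrow> bool" where
  Const: "exec (Const x k) (r, h) 1 (r(x := k), h)"
| Add: "exec (Add x y z) (r, h) 1 (r(x := r y + r z), h)"
| Sub: "exec (Sub x y z) (r, h) 1 (r(x := r y - r z), h)"
| Load: "exec (Load x y) (r, h) 1 (r(x := h (r y)), h)"
| Store: "exec (Store x y) (r, h) 1 (r, h(r x := r y))"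
| Seq: "exec c1 s1 t1 s2 \<Longrightarrow> exec c2 s2 t2 s3 \<Longrightarrow> exec (Seq c1 c2) s1 (t1 + t2) s3"
| IfTrue: "r x < r y \<Longrightarrow> exec c1 (r, h) t s \<Longrightarrow> exec (IfLess x y c1 c2) (r, h) (t + 1) s"
| IfFalse: "\<not> r x < r y \<Longrightarrow> exec c2 (r, h) t s \<Longrightarrow> exec (IfLess x y c1 c2) (r, h) (t + 1) s"
| WhileFalse: "\<not> r x < r y \<Longrightarrow> exec (WhileLess x y c) (r, h) 1 (r, h)"
| WhileTrue: "r x < r y \<Longrightarrow> exec c (r, h) t1 s2 \<Longrightarrow> exec (WhileLess x y c) s2 t2 s3 \<Longrightarrow>
    exec (WhileLess x y c) (r, h) (t1 + t2 + 1) s3"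

lemma exec_deterministic:
  "exec c s t s' \<Longrightarrow> exec c s u s'' \<Longrightarrow> t = u \<and> s' = s''"
proof (induction arbitrary: u s'' rule: exec.induct)
  case (Seq c1 s1 t1 s2 c2 t2 s3)
  from Seq.prems show ?case by cases (use Seq.IH in blast)
next
  case (WhileTrue r x y c h t1 s2 t2 s3)
  from WhileTrue.prems show ?case
    by cases (use WhileTrue.IH WhileTrue.hyps(1) in blast)+
qed (erule exec.cases; fastforce)+

text \<open>The input is written to the memory cells \<open>0, 1, \<dots>\<close>; everything else is initially zero.\<close>

definition input_state :: "nat list \<Rightarrow> state" where
  "input_state xs = (\<lambda>_. 0, \<lambda>i. if i < length xs then xs ! i else 0)"

text \<open>The answer is read off register \<open>0\<close>.\<close>

definition answers_within :: "com \<Rightarrow> nat list \<Rightarrow> bool \<Rightarrow> nat \<Rightarrow> bool" where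
  "answers_within prog xs b T \<longleftrightarrow>
     (\<exists>t r h. exec prog (input_state xs) t (r, h) \<and> t \<le> T \<and> r 0 = (if b then 1 else 0))"


section \<open>Encoding of instances\<close>

text \<open>
  The preference list of an agent enumerates its acceptable items from the least to the most
  preferred one. It exists and is unique, see \<open>ex1_pref_list\<close> below.
\<close>

definition pref_list :: "('a, 'i) goa \<Rightarrow> nat \<Rightarrow> 'a \<Rightarrow> 'i list" where
  "pref_list inst j a =
     (THE xs. set xs = acceptable inst j a \<and> sorted_wrt (\<lambda>x y. (x, y) \<in> pref inst j a) xs)"

lemma strict_linear_order_ex1_list:
  assumes "finite A" "strict_linear_order_on A R"
  shows "\<exists>!xs. set xs = A \<and> sorted_wrt (\<lambda>x y. (x, y) \<in> R) xs"
proof (rule ex_ex1I)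
  have tr: "trans R" and ir: "\<And>x. (x, x) \<notin> R"
    using assms(2) by (auto simp: strict_linear_order_on_def irrefl_def)
  have tot: "total_on A R" using assms(2) by (simp add: strict_linear_order_on_def)
  show "\<exists>xs. set xs = A \<and> sorted_wrt (\<lambda>x y. (x, y) \<in> R) xs"
    using assms(1) tot
  proof (induction A rule: finite_induct)
    case (insert x A)
    then obtain xs where xs: "set xs = A" "sorted_wrt (\<lambda>x y. (x, y) \<in> R) xs"
      by (auto simp: total_on_def)
    have "y = x \<or> (y, x) \<in> R \<or> (x, y) \<in> R" if "y \<in> A" for y
      using insert.prems that by (auto simp: total_on_def)
    then have "set (filter (\<lambda>y. (y, x) \<in> R) xs @ x # filter (\<lambda>y. (x, y) \<in> R) xs) = insert x A"
      using xs(1) insert.hyps(2) by auto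
    moreover have "sorted_wrt (\<lambda>x y. (x, y) \<in> R)
        (filter (\<lambda>y. (y, x) \<in> R) xs @ x # filter (\<lambda>y. (x, y) \<in> R) xs)"
      using xs(2) tr by (auto simp: sorted_wrt_append sorted_wrt_filter intro: transD)
    ultimately show ?case by blast
  qed simp
  have "xs = ys" if "set xs = set ys" "sorted_wrt (\<lambda>x y. (x, y) \<in> R) xs"
    "sorted_wrt (\<lambda>x y. (x, y) \<in> R) ys" for xs ys
    using that
  proof (induction xs arbitrary: ys)
    case (Cons x xs)
    then obtain y zs where ys: "ys = y # zs" by (cases ys) auto
    have "x = y"
    proof (rule ccontr)
      assume "x \<noteq> y"
      then have "x \<in> set zs" "y \<in> set xs" using Cons.prems(1) ys by auto
      then have "(x, y) \<in> R" "(y, x) \<in> R" using Cons.prems ys by auto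
      then show False using tr ir by (meson transD)
    qed
    moreover have "x \<notin> set xs" "y \<notin> set zs" using Cons.prems ys ir by auto
    ultimately have "set xs = set zs" using Cons.prems(1) ys by auto
    then show ?case using Cons ys \<open>x = y\<close> by auto
  qed simp
  then show "xs = ys" if "set xs = A \<and> sorted_wrt (\<lambda>x y. (x, y) \<in> R) xs"
    "set ys = A \<and> sorted_wrt (\<lambda>x y. (x, y) \<in> R) ys" for xs ys using that by simp
qed

lemma ex1_pref_list:
  assumes "goa_instance inst" "j \<in> {1..layers inst}" "a \<in> agents inst"
  shows "\<exists>!xs. set xs = acceptable inst j a \<and> sorted_wrt (\<lambda>x y. (x, y) \<in> pref inst j a) xs"
proof (rule strict_linear_order_ex1_list)
  show "finite (acceptable inst j a)"
    using assms by (meson goa_instance_def finite_subset)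
  show "strict_linear_order_on (acceptable inst j a) (pref inst j a)"
    using assms by (simp add: goa_instance_def)
qed

text \<open>
  An instance with agents \<open>0, \<dots>, n - 1\<close> and items \<open>0, \<dots>, m - 1\<close> is given to the machine as
  the numbers \<open>n\<close>, \<open>m\<close>, \<open>\<ell>\<close>, \<open>\<alpha>\<close>, followed by the preference lists of all agents in layer 1,
  then those in layer 2, and so on; each list is preceded by its length.
\<close>

definition encode :: "(nat, nat) goa \<Rightarrow> nat list" where
  "encode inst =
     [card (agents inst), card (items inst), layers inst, alpha inst] @
     concat (map (\<lambda>j. concat (map (\<lambda>a. length (pref_list inst j a) # pref_list inst j a)
                                   [0..<card (agents inst)]))
                 [1..<Suc (layers inst)])"

end

theory Submission
  imports Defs
begin

text \<open>
  Exhaustive search suffices. Each assignment is determined by the owner of every item, hence coded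
  by a number below \<open>N = (n + 1) ^ m\<close>, and Pareto optimality in a layer is tested by comparing with
  all \<open>N\<close> codes. A single test costs \<open>N ^ O(1)\<close>, since \<open>n\<close> and \<open>m\<close> are at most \<open>N\<close> when both are
  positive, and \<open>N \<le> 2 (n m) ^ (2 m)\<close>. Digits of codes are recomputed arithmetically whenever they
  are needed, so that the machine never writes to its memory. The positions of the layers in the
  input are found by walking along it once per candidate, which keeps the time linear in the number
  of layers. If \<open>n = 0\<close> or \<open>m = 0\<close>, the empty assignment is optimal in all layers, and the input must
  not even be read to stay within the time bound.
\<close>

section \<open>An expression language for the machine\<close>

datatype 'v expr =
    Var 'v
  | Lit nat
  | Plus "'v expr" "'v expr"
  | Minus "'v expr" "'v expr"
  | Mem "'v expr"
  | If_Less "'v expr" "'v expr" "'v expr" "'v expr"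
  | Sum 'v "'v expr" "'v expr" "'v expr" "'v expr"

text \<open>\<open>Sum x z b d e\<close> adds up the values of \<open>e\<close> while \<open>x\<close> starts at \<open>z\<close> and is replaced
  \<open>b\<close> times by \<open>d\<close>. Combining iteration and summation makes this the only loop needed: products,
  powers and quotients as well as walks along the input are such sums.\<close>

primrec eval :: "(nat \<Rightarrow> nat) \<Rightarrow> 'v expr \<Rightarrow> ('v \<Rightarrow> nat) \<Rightarrow> nat" where
  "eval h (Var x) \<rho> = \<rho> x"
| "eval h (Lit k) \<rho> = k"
| "eval h (Plus a b) \<rho> = eval h a \<rho> + eval h b \<rho>"
| "eval h (Minus a b) \<rho> = eval h a \<rho> - eval h b \<rho>"
| "eval h (Mem a) \<rho> = h (eval h a \<rho>)"
| "eval h (If_Less a b c d) \<rho> = (if eval h a \<rho> < eval h b \<rho> then eval h c \<rho> else eval h d \<rho>)"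
| "eval h (Sum x z b d e) \<rho> =
     (\<Sum>k<eval h b \<rho>. eval h e (\<rho>(x := ((\<lambda>v. eval h d (\<rho>(x := v))) ^^ k) (eval h z \<rho>))))"

text \<open>The exact step count of compiled code. A variable takes two steps because copying is
  \<open>Const\<close> followed by \<open>Add\<close>. In \<open>Sum\<close> the outer 4 is three
  constants and the failing last test; the 4 per round is the test, the accumulation, the update of
  the variable and the countdown. The update \<open>d\<close> runs even after the last
  summand.\<close>

primrec cost :: "(nat \<Rightarrow> nat) \<Rightarrow> 'v expr \<Rightarrow> ('v \<Rightarrow> nat) \<Rightarrow> nat" where
  "cost h (Var x) \<rho> = 2"
| "cost h (Lit k) \<rho> = 1"
| "cost h (Plus a b) \<rho> = cost h a \<rho> + cost h b \<rho> + 1"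
| "cost h (Minus a b) \<rho> = cost h a \<rho> + cost h b \<rho> + 1"
| "cost h (Mem a) \<rho> = cost h a \<rho> + 1"
| "cost h (If_Less a b c d) \<rho> = cost h a \<rho> + cost h b \<rho> +
     (if eval h a \<rho> < eval h b \<rho> then cost h c \<rho> else cost h d \<rho>) + 1"
| "cost h (Sum x z b d e) \<rho> = cost h z \<rho> + cost h b \<rho> + 4 +
     (\<Sum>k<eval h b \<rho>. cost h e (\<rho>(x := ((\<lambda>v. eval h d (\<rho>(x := v))) ^^ k) (eval h z \<rho>))) +
        cost h d (\<rho>(x := ((\<lambda>v. eval h d (\<rho>(x := v))) ^^ k) (eval h z \<rho>))) + 4)"

text \<open>\<open>R\<close> tells which register holds a variable. The result goes to register \<open>k\<close>, and all
  registers below \<open>k\<close> are preserved.\<close>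

primrec compile :: "('v \<Rightarrow> nat) \<Rightarrow> nat \<Rightarrow> 'v expr \<Rightarrow> com" where
  "compile R k (Var x) = Seq (Const k 0) (Add k k (R x))"
| "compile R k (Lit i) = Const k i"
| "compile R k (Plus a b) =
     Seq (compile R k a) (Seq (compile R (Suc k) b) (Add k k (Suc k)))"
| "compile R k (Minus a b) =
     Seq (compile R k a) (Seq (compile R (Suc k) b) (Sub k k (Suc k)))"
| "compile R k (Mem a) = Seq (compile R k a) (Load k k)"
| "compile R k (If_Less a b c d) =
     Seq (compile R k a) (Seq (compile R (Suc k) b)
       (IfLess k (Suc k) (compile R k c) (compile R k d)))"
| "compile R k (Sum x z b d e) =
     Seq (Const k 0) (Seq (compile R (k + 1) z) (Seq (compile R (k + 2) b)
       (Seq (Const (k + 3) 0) (Seq (Const (k + 4) 1)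
         (WhileLess (k + 3) (k + 2)
           (Seq (compile (R(x := k + 1)) (k + 5) e) (Seq (Add k k (k + 5))
             (Seq (compile (R(x := k + 1)) (k + 5) d) (Seq (Add (k + 1) (k + 5) (k + 3))
               (Sub (k + 2) (k + 2) (k + 4)))))))))))"

section \<open>Correctness and exact cost of compiled expressions\<close>

definition implements ::
    "com \<Rightarrow> ('v \<Rightarrow> nat) \<Rightarrow> nat \<Rightarrow> (nat \<Rightarrow> nat) \<Rightarrow> 'v expr \<Rightarrow> bool" where
  "implements c R k h e \<longleftrightarrow> (\<forall>r \<rho>. (\<forall>x. r (R x) = \<rho> x) \<longrightarrow>
     (\<exists>r'. exec c (r, h) (cost h e \<rho>) (r', h) \<and> r' k = eval h e \<rho> \<and> (\<forall>y<k. r' y = r y)))"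

lemma implementsD:
  assumes "implements c R k h e" "\<And>x. r (R x) = \<rho> x"
  obtains r' where "exec c (r, h) (cost h e \<rho>) (r', h)" "r' k = eval h e \<rho>"
    "\<And>y. y < k \<Longrightarrow> r' y = r y"
  using assms unfolding implements_def by blast

text \<open>Register \<open>k\<close> accumulates, \<open>k + 1\<close> holds the loop variable,
  \<open>k + 2\<close> the remaining rounds, \<open>k + 3\<close> and \<open>k + 4\<close> the
  constants 0 and 1; subexpressions work from \<open>k + 5\<close> on. The induction on
  \<open>B\<close> generalises \<open>r\<close> and \<open>v\<close>, as one round leaves a shorter
  loop started at \<open>f v\<close>.\<close>

lemma exec_Sum_loop:
  fixes R :: "'v \<Rightarrow> nat" and \<rho> :: "'v \<Rightarrow> nat"
  assumes ce: "implements ce (R(x := k + 1)) (k + 5) h e"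
    and cd: "implements cd (R(x := k + 1)) (k + 5) h d"
    and R: "\<And>x. R x < k"
    and r: "\<And>x. r (R x) = \<rho> x" "r (k + 1) = v" "r (k + 2) = B" "r (k + 3) = 0" "r (k + 4) = 1"
  defines "f \<equiv> \<lambda>v. eval h d (\<rho>(x := v))"
  shows "\<exists>r'. exec (WhileLess (k + 3) (k + 2) (Seq ce (Seq (Add k k (k + 5))
             (Seq cd (Seq (Add (k + 1) (k + 5) (k + 3)) (Sub (k + 2) (k + 2) (k + 4))))))) (r, h)
      (1 + (\<Sum>j<B. cost h e (\<rho>(x := (f ^^ j) v)) + cost h d (\<rho>(x := (f ^^ j) v)) + 4)) (r', h) \<and>
      r' k = r k + (\<Sum>j<B. eval h e (\<rho>(x := (f ^^ j) v))) \<and> (\<forall>y<k. r' y = r y)"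
  using r
proof (induction B arbitrary: r v)
  case 0
  then have "\<not> r (k + 3) < r (k + 2)" by simp
  from exec.WhileFalse[of r, OF this] show ?case by auto
next
  case (Suc B)
  let ?R = "R(x := k + 1)" and ?\<rho> = "\<rho>(x := v)"
  let ?body = "Seq ce (Seq (Add k k (k + 5))
             (Seq cd (Seq (Add (k + 1) (k + 5) (k + 3)) (Sub (k + 2) (k + 2) (k + 4)))))"
  have r0: "r (?R y) = ?\<rho> y" for y using Suc.prems by auto
  obtain r1 where r1:
    "exec ce (r, h) (cost h e ?\<rho>) (r1, h)" "r1 (k + 5) = eval h e ?\<rho>"
    "\<And>y. y < k + 5 \<Longrightarrow> r1 y = r y"
    by (rule implementsD[OF ce, of r ?\<rho>, OF r0]) (rule that)
  define r2 where "r2 = r1(k := r1 k + r1 (k + 5))"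
  have r2: "r2 (?R y) = ?\<rho> y" for y
    using Suc.prems(1)[of y] Suc.prems(2) R[of y] r1(3) by (auto simp: r2_def)
  obtain r3 where r3:
    "exec cd (r2, h) (cost h d ?\<rho>) (r3, h)" "r3 (k + 5) = eval h d ?\<rho>"
    "\<And>y. y < k + 5 \<Longrightarrow> r3 y = r2 y"
    by (rule implementsD[OF cd, of r2 ?\<rho>, OF r2]) (rule that)
  define r4 where "r4 = r3(k + 1 := r3 (k + 5) + r3 (k + 3))"
  define r5 where "r5 = r4(k + 2 := r4 (k + 2) - r4 (k + 4))"
  have step: "exec ?body (r, h) (cost h e ?\<rho> + (1 + (cost h d ?\<rho> + (1 + 1)))) (r5, h)"
    unfolding r5_def r4_def
    by (intro exec.Seq[OF r1(1)] exec.Seq[OF exec.Add] exec.Sub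
        exec.Seq[OF r3(1)[unfolded r2_def]])
  have r5: "r5 (k + 1) = f v" "r5 (k + 2) = B" "r5 (k + 3) = 0" "r5 (k + 4) = 1"
    "r5 k = r k + eval h e ?\<rho>" "y < k \<Longrightarrow> r5 y = r y" for y
    using Suc.prems r1 r3 by (auto simp: r5_def r4_def r2_def f_def)
  have "r5 (R y) = \<rho> y" for y using r5(6)[OF R] Suc.prems(1) by simp
  from Suc.IH[OF this r5(1-4)] obtain r' where r':
    "exec (WhileLess (k + 3) (k + 2) ?body) (r5, h)
      (1 + (\<Sum>j<B. cost h e (\<rho>(x := (f ^^ j) (f v))) + cost h d (\<rho>(x := (f ^^ j) (f v))) + 4)) (r', h)"
    "r' k = r5 k + (\<Sum>j<B. eval h e (\<rho>(x := (f ^^ j) (f v))))" "\<forall>y<k. r' y = r5 y" by blast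
  have "r (k + 3) < r (k + 2)" using Suc.prems by simp
  note loop = exec.WhileTrue[OF this step r'(1)]
  \<comment> \<open>Splits off the first round by \<open>(f ^^ Suc j) v = (f ^^ j) (f v)\<close>,
    the form in which the induction hypothesis speaks of the others.\<close>
  have shift: "(\<Sum>j<Suc B. g ((f ^^ j) v)) = g v + (\<Sum>j<B. g ((f ^^ j) (f v)))"
    for g :: "nat \<Rightarrow> nat"
    by (simp add: sum.lessThan_Suc_shift funpow_Suc_right del: sum.lessThan_Suc funpow.simps)
  show ?case
    unfolding shift[of "\<lambda>v. cost h e (\<rho>(x := v)) + cost h d (\<rho>(x := v)) + 4"]
      shift[of "\<lambda>v. eval h e (\<rho>(x := v))"]
  proof (intro exI[of _ r'] conjI)
    show "exec (WhileLess (k + 3) (k + 2) ?body) (r, h)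
      (1 + (cost h e ?\<rho> + cost h d ?\<rho> + 4 +
        (\<Sum>j<B. cost h e (\<rho>(x := (f ^^ j) (f v))) + cost h d (\<rho>(x := (f ^^ j) (f v))) + 4))) (r', h)"
      by (rule back_subst[of "\<lambda>t. exec _ _ t _", OF loop]) simp
  qed (use r'(2,3) r5(5,6) in auto)
qed

text \<open>The first operand stays in register \<open>k\<close> while the second is computed in
  \<open>Suc k\<close>. The continuation \<open>c3\<close> is left open so that an addition, a
  subtraction or a branch can follow.\<close>

lemma exec_Seq_Suc:
  fixes \<rho> :: "'v \<Rightarrow> nat"
  assumes "implements c1 R k h a" "implements c2 R (Suc k) h b" "\<And>x. R x < k" "\<And>x. r (R x) = \<rho> x"
  obtains r' where
    "\<And>c3 t s. exec c3 (r', h) t s \<Longrightarrow>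
       exec (Seq c1 (Seq c2 c3)) (r, h) (cost h a \<rho> + (cost h b \<rho> + t)) s"
    "r' k = eval h a \<rho>" "r' (Suc k) = eval h b \<rho>" "\<And>y. y < k \<Longrightarrow> r' y = r y"
proof -
  obtain r1 where r1: "exec c1 (r, h) (cost h a \<rho>) (r1, h)"
    "r1 k = eval h a \<rho>" "\<And>y. y < k \<Longrightarrow> r1 y = r y"
    by (rule implementsD[OF assms(1), of r \<rho>, OF assms(4)]) (rule that)
  have r1': "r1 (R x) = \<rho> x" for x using r1(3)[OF assms(3)] assms(4) by simp
  obtain r2 where r2: "exec c2 (r1, h) (cost h b \<rho>) (r2, h)"
    "r2 (Suc k) = eval h b \<rho>" "\<And>y. y < Suc k \<Longrightarrow> r2 y = r1 y"
    by (rule implementsD[OF assms(2), of r1 \<rho>, OF r1']) (rule that)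
  show thesis
  proof (rule that)
    show "exec (Seq c1 (Seq c2 c3)) (r, h) (cost h a \<rho> + (cost h b \<rho> + t)) s"
      if "exec c3 (r2, h) t s" for c3 t s
      using exec.Seq[OF r1(1) exec.Seq[OF r2(1) that]] .
  qed (use r1 r2 in auto)
qed

text \<open>\<open>R\<close> and \<open>k\<close> are generalised because operands are compiled at
  larger registers and \<open>Sum\<close> redirects its variable to \<open>k + 1\<close>. Variables
  lie below \<open>k\<close>, and code preserves all registers below its target, so the environment
  survives every evaluation.\<close>

lemma compile_correct: "(\<And>x. R x < k) \<Longrightarrow> implements (compile R k e) R k h e"
proof (induction e arbitrary: R k)
  case (Var x)
  have "exec (compile R k (Var x)) (r, h) (1 + 1) ((r(k := 0))(k := (r(k := 0)) k + (r(k := 0)) (R x)), h)"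
    for r unfolding compile.simps by (intro exec.Seq[OF exec.Const] exec.Add)
  moreover have "R x \<noteq> k" using Var[of x] by simp
  ultimately show ?case unfolding implements_def
    by (fastforce simp: numeral_2_eq_2)
next
  case (Lit i)
  have "exec (compile R k (Lit i)) (r, h) 1 (r(k := i), h)" for r
    unfolding compile.simps by (rule exec.Const)
  then show ?case unfolding implements_def by fastforce
next
  case (Plus a b)
  show ?case unfolding implements_def
  proof (intro allI impI)
    fix r and \<rho> :: "_ \<Rightarrow> nat" assume r: "\<forall>x. r (R x) = \<rho> x"
    obtain r' where r':
      "\<And>c3 t s. exec c3 (r', h) t s \<Longrightarrow>
         exec (Seq (compile R k a) (Seq (compile R (Suc k) b) c3)) (r, h)
           (cost h a \<rho> + (cost h b \<rho> + t)) s"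
      "r' k = eval h a \<rho>" "r' (Suc k) = eval h b \<rho>" "\<And>y. y < k \<Longrightarrow> r' y = r y"
      by (rule exec_Seq_Suc[OF Plus.IH(1)[of R k, OF Plus.prems]
            Plus.IH(2)[of R "Suc k", OF less_SucI[OF Plus.prems]] Plus.prems,
            of r \<rho>, OF r[rule_format]]) (rule that)
    from r'(1)[OF exec.Add[of k k "Suc k"]]
    show "\<exists>r'. exec (compile R k (Plus a b)) (r, h) (cost h (Plus a b) \<rho>) (r', h) \<and>
        r' k = eval h (Plus a b) \<rho> \<and> (\<forall>y<k. r' y = r y)"
      using r'(2-4) by (intro exI[of _ "r'(k := r' k + r' (Suc k))"]) (simp add: add_ac)
  qed
next
  case (Minus a b)
  show ?case unfolding implements_def
  proof (intro allI impI)
    fix r and \<rho> :: "_ \<Rightarrow> nat" assume r: "\<forall>x. r (R x) = \<rho> x"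
    obtain r' where r':
      "\<And>c3 t s. exec c3 (r', h) t s \<Longrightarrow>
         exec (Seq (compile R k a) (Seq (compile R (Suc k) b) c3)) (r, h)
           (cost h a \<rho> + (cost h b \<rho> + t)) s"
      "r' k = eval h a \<rho>" "r' (Suc k) = eval h b \<rho>" "\<And>y. y < k \<Longrightarrow> r' y = r y"
      by (rule exec_Seq_Suc[OF Minus.IH(1)[of R k, OF Minus.prems]
            Minus.IH(2)[of R "Suc k", OF less_SucI[OF Minus.prems]] Minus.prems,
            of r \<rho>, OF r[rule_format]]) (rule that)
    from r'(1)[OF exec.Sub[of k k "Suc k"]]
    show "\<exists>r'. exec (compile R k (Minus a b)) (r, h) (cost h (Minus a b) \<rho>) (r', h) \<and>
        r' k = eval h (Minus a b) \<rho> \<and> (\<forall>y<k. r' y = r y)"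
      using r'(2-4) by (intro exI[of _ "r'(k := r' k - r' (Suc k))"]) (simp add: add_ac)
  qed
next
  case (Mem a)
  show ?case unfolding implements_def
  proof (intro allI impI)
    fix r and \<rho> :: "_ \<Rightarrow> nat" assume r: "\<forall>x. r (R x) = \<rho> x"
    obtain r1 where r1: "exec (compile R k a) (r, h) (cost h a \<rho>) (r1, h)"
      "r1 k = eval h a \<rho>" "\<And>y. y < k \<Longrightarrow> r1 y = r y"
      by (rule implementsD[OF Mem.IH[of R k, OF Mem.prems], of r \<rho>, OF r[rule_format]]) (rule that)
    show "\<exists>r'. exec (compile R k (Mem a)) (r, h) (cost h (Mem a) \<rho>) (r', h) \<and>
        r' k = eval h (Mem a) \<rho> \<and> (\<forall>y<k. r' y = r y)"
      using exec.Seq[OF r1(1) exec.Load[of k k]] r1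
      by (intro exI[of _ "r1(k := h (r1 k))"]) simp
  qed
next
  case (If_Less a b c d)
  show ?case unfolding implements_def
  proof (intro allI impI)
    fix r and \<rho> :: "_ \<Rightarrow> nat" assume r: "\<forall>x. r (R x) = \<rho> x"
    obtain r2 where r2:
      "\<And>c3 t s. exec c3 (r2, h) t s \<Longrightarrow>
         exec (Seq (compile R k a) (Seq (compile R (Suc k) b) c3)) (r, h)
           (cost h a \<rho> + (cost h b \<rho> + t)) s"
      "r2 k = eval h a \<rho>" "r2 (Suc k) = eval h b \<rho>" "\<And>y. y < k \<Longrightarrow> r2 y = r y"
      by (rule exec_Seq_Suc[OF If_Less.IH(1)[of R k, OF If_Less.prems]
            If_Less.IH(2)[of R "Suc k", OF less_SucI[OF If_Less.prems]] If_Less.prems,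
            of r \<rho>, OF r[rule_format]]) (rule that)
    have r2': "r2 (R x) = \<rho> x" for x using r2(4)[OF If_Less.prems] r by simp
    obtain r3 where r3: "exec (compile R k c) (r2, h) (cost h c \<rho>) (r3, h)"
      "r3 k = eval h c \<rho>" "\<And>y. y < k \<Longrightarrow> r3 y = r2 y"
      by (rule implementsD[OF If_Less.IH(3)[of R k, OF If_Less.prems], of r2 \<rho>, OF r2']) (rule that)
    obtain r4 where r4: "exec (compile R k d) (r2, h) (cost h d \<rho>) (r4, h)"
      "r4 k = eval h d \<rho>" "\<And>y. y < k \<Longrightarrow> r4 y = r2 y"
      by (rule implementsD[OF If_Less.IH(4)[of R k, OF If_Less.prems], of r2 \<rho>, OF r2']) (rule that)
    show "\<exists>r'. exec (compile R k (If_Less a b c d)) (r, h) (cost h (If_Less a b c d) \<rho>) (r', h) \<and>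
        r' k = eval h (If_Less a b c d) \<rho> \<and> (\<forall>y<k. r' y = r y)"
    proof (cases "eval h a \<rho> < eval h b \<rho>")
      case True
      then have "r2 k < r2 (Suc k)" using r2 by simp
      from r2(1)[OF exec.IfTrue[OF this r3(1)]] True
      show ?thesis using r2 r3 by (intro exI[of _ r3]) (simp add: add_ac)
    next
      case False
      then have "\<not> r2 k < r2 (Suc k)" using r2 by simp
      from r2(1)[OF exec.IfFalse[OF this r4(1)]] False
      show ?thesis using r2 r4 by (intro exI[of _ r4]) (simp add: add_ac)
    qed
  qed
next
  case (Sum x z b d e)
  have ce: "implements (compile (R(x := k + 1)) (k + 5) e) (R(x := k + 1)) (k + 5) h e"
    and cd: "implements (compile (R(x := k + 1)) (k + 5) d) (R(x := k + 1)) (k + 5) h d"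
    using Sum.prems by (auto intro!: Sum.IH simp: trans_less_add1)
  have cz: "implements (compile R (k + 1) z) R (k + 1) h z"
    and cb: "implements (compile R (k + 2) b) R (k + 2) h b"
    using Sum.prems by (auto intro!: Sum.IH simp: trans_less_add1 less_SucI)
  show ?case unfolding implements_def
  proof (intro allI impI)
    fix r and \<rho> :: "_ \<Rightarrow> nat" assume r: "\<forall>x. r (R x) = \<rho> x"
    have Rk: "R y < k" "R y \<noteq> k" for y using Sum.prems[of y] by auto
    have r0: "(r(k := 0)) (R y) = \<rho> y" for y using r Rk by auto
    obtain r1 where
      r1: "exec (compile R (k + 1) z) (r(k := 0), h) (cost h z \<rho>) (r1, h)"
      "r1 (k + 1) = eval h z \<rho>" "\<And>y. y < k + 1 \<Longrightarrow> r1 y = (r(k := 0)) y"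
      by (rule implementsD[OF cz, of "r(k := 0)" \<rho>, OF r0]) (rule that)
    have r1': "r1 (R y) = \<rho> y" for y using r1(3)[of "R y"] r Rk[of y] by simp
    obtain r2 where
      r2: "exec (compile R (k + 2) b) (r1, h) (cost h b \<rho>) (r2, h)"
      "r2 (k + 2) = eval h b \<rho>" "\<And>y. y < k + 2 \<Longrightarrow> r2 y = r1 y"
      by (rule implementsD[OF cb, of r1 \<rho>, OF r1']) (rule that)
    define r3 where "r3 = r2(k + 3 := 0, k + 4 := 1)"
    have r3: "r3 (k + 1) = eval h z \<rho>" "r3 (k + 2) = eval h b \<rho>" "r3 (k + 3) = 0"
      "r3 (k + 4) = 1" "r3 k = 0" "y < k \<Longrightarrow> r3 y = r y" for y
      using r1 r2 by (auto simp: r3_def)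
    have "r3 (R y) = \<rho> y" for y using r3(6)[OF Rk(1)] r by simp
    from exec_Sum_loop[OF ce cd Sum.prems this r3(1-4)] r3(5,6) obtain r' where
      r': "exec (WhileLess (k + 3) (k + 2)
           (Seq (compile (R(x := k + 1)) (k + 5) e) (Seq (Add k k (k + 5))
             (Seq (compile (R(x := k + 1)) (k + 5) d) (Seq (Add (k + 1) (k + 5) (k + 3))
               (Sub (k + 2) (k + 2) (k + 4))))))) (r3, h)
      (1 + (\<Sum>k<eval h b \<rho>. cost h e (\<rho>(x := ((\<lambda>v. eval h d (\<rho>(x := v))) ^^ k) (eval h z \<rho>))) +
        cost h d (\<rho>(x := ((\<lambda>v. eval h d (\<rho>(x := v))) ^^ k) (eval h z \<rho>))) + 4)) (r', h)"
      "r' k = eval h (Sum x z b d e) \<rho>" "\<forall>y<k. r' y = r y" by auto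
    note run = exec.Seq[OF exec.Const exec.Seq[OF r1(1) exec.Seq[OF r2(1)
          exec.Seq[OF exec.Const exec.Seq[OF exec.Const r'(1)[unfolded r3_def]]]]]]
    have "exec (compile R k (Sum x z b d e)) (r, h) (cost h (Sum x z b d e) \<rho>) (r', h)"
      unfolding compile.simps by (rule back_subst[of "\<lambda>t. exec _ _ t _", OF run]) simp
    then show "\<exists>r'. exec (compile R k (Sum x z b d e)) (r, h) (cost h (Sum x z b d e) \<rho>) (r', h) \<and>
        r' k = eval h (Sum x z b d e) \<rho> \<and> (\<forall>y<k. r' y = r y)"
      using r'(2,3) by blast
  qed
qed

section \<open>Polynomial bounds on the cost\<close>

primrec loops_le :: "nat \<Rightarrow> (nat \<Rightarrow> nat) \<Rightarrow> 'v expr \<Rightarrow> ('v \<Rightarrow> nat) \<Rightarrow> bool" where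
  "loops_le M h (Var x) \<rho> \<longleftrightarrow> True"
| "loops_le M h (Lit k) \<rho> \<longleftrightarrow> True"
| "loops_le M h (Plus a b) \<rho> \<longleftrightarrow> loops_le M h a \<rho> \<and> loops_le M h b \<rho>"
| "loops_le M h (Minus a b) \<rho> \<longleftrightarrow> loops_le M h a \<rho> \<and> loops_le M h b \<rho>"
| "loops_le M h (Mem a) \<rho> \<longleftrightarrow> loops_le M h a \<rho>"
| "loops_le M h (If_Less a b c d) \<rho> \<longleftrightarrow> loops_le M h a \<rho> \<and> loops_le M h b \<rho> \<and>
     loops_le M h c \<rho> \<and> loops_le M h d \<rho>"
| "loops_le M h (Sum x z b d e) \<rho> \<longleftrightarrow> loops_le M h z \<rho> \<and> loops_le M h b \<rho> \<and> eval h b \<rho> \<le> M \<and>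
     (\<forall>k<eval h b \<rho>. loops_le M h e (\<rho>(x := ((\<lambda>v. eval h d (\<rho>(x := v))) ^^ k) (eval h z \<rho>))) \<and>
        loops_le M h d (\<rho>(x := ((\<lambda>v. eval h d (\<rho>(x := v))) ^^ k) (eval h z \<rho>))))"

text \<open>Serves both as coefficient and as exponent of \<open>M\<close> in the cost bound. The 8
  for \<open>Sum\<close> combines the 4 steps of setup with the 4 steps per round.\<close>

primrec weight :: "'v expr \<Rightarrow> nat" where
  "weight (Var x) = 2"
| "weight (Lit k) = 1"
| "weight (Plus a b) = weight a + weight b + 1"
| "weight (Minus a b) = weight a + weight b + 1"
| "weight (Mem a) = weight a + 1"
| "weight (If_Less a b c d) = weight a + weight b + weight c + weight d + 1"
| "weight (Sum x z b d e) = weight z + weight b + weight d + weight e + 8"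

text \<open>Keeps the number of rounds as an explicit factor, so that it also serves the loop over
  the layers, whose number is not bounded in terms of \<open>n\<close> and \<open>m\<close>.\<close>

lemma cost_Sum_le:
  assumes "\<And>k. k < eval h b \<rho> \<Longrightarrow>
    cost h e (\<rho>(x := ((\<lambda>v. eval h d (\<rho>(x := v))) ^^ k) (eval h z \<rho>))) +
    cost h d (\<rho>(x := ((\<lambda>v. eval h d (\<rho>(x := v))) ^^ k) (eval h z \<rho>))) \<le> K"
  shows "cost h (Sum x z b d e) \<rho> \<le> cost h z \<rho> + cost h b \<rho> + 4 + eval h b \<rho> * (K + 4)"
proof -
  have "(\<Sum>k<eval h b \<rho>. cost h e (\<rho>(x := ((\<lambda>v. eval h d (\<rho>(x := v))) ^^ k) (eval h z \<rho>))) +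
        cost h d (\<rho>(x := ((\<lambda>v. eval h d (\<rho>(x := v))) ^^ k) (eval h z \<rho>))) + 4)
      \<le> (\<Sum>k<eval h b \<rho>. K + 4)"
    by (rule sum_mono) (use assms in simp)
  then show ?thesis by simp
qed

lemma le_mult_power_mono:
  fixes c :: nat
  assumes "c \<le> i * M ^ i" "1 \<le> M" "i \<le> j"
  shows "c \<le> i * M ^ j"
  using assms by (meson mult_le_mono2 order_trans power_increasing)

lemma cost_le_power:
  assumes "1 \<le> M" "loops_le M h e \<rho>"
  shows "cost h e \<rho> \<le> weight e * M ^ weight e"
  using assms(2)
proof (induction e arbitrary: \<rho>)
  case (Var x)
  then show ?case using assms(1) by (simp add: one_le_power)
next
  case (Lit x)
  then show ?case using assms(1) by simp
next
  case (Plus a b)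
  define w where "w = weight (Plus a b)"
  have le: "weight a \<le> w" "weight b \<le> w" by (simp_all add: w_def)
  have "cost h a \<rho> \<le> weight a * M ^ w" "cost h b \<rho> \<le> weight b * M ^ w"
    using Plus.prems le
    by (auto intro!: Plus.IH[THEN le_mult_power_mono, OF _ assms(1)])
  then have "cost h (Plus a b) \<rho> \<le> weight a * M ^ w + weight b * M ^ w + M ^ w"
    using one_le_power[OF assms(1), of w] by simp
  also have "\<dots> = weight (Plus a b) * M ^ w" by (simp add: algebra_simps)
  finally show ?case by (simp only: w_def)
next
  case (Minus a b)
  define w where "w = weight (Minus a b)"
  have le: "weight a \<le> w" "weight b \<le> w" by (simp_all add: w_def)
  have "cost h a \<rho> \<le> weight a * M ^ w" "cost h b \<rho> \<le> weight b * M ^ w"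
    using Minus.prems le
    by (auto intro!: Minus.IH[THEN le_mult_power_mono, OF _ assms(1)])
  then have "cost h (Minus a b) \<rho> \<le> weight a * M ^ w + weight b * M ^ w + M ^ w"
    using one_le_power[OF assms(1), of w] by simp
  also have "\<dots> = weight (Minus a b) * M ^ w" by (simp add: algebra_simps)
  finally show ?case by (simp only: w_def)
next
  case (Mem a)
  define w where "w = weight (Mem a)"
  have le: "weight a \<le> w" by (simp_all add: w_def)
  have "cost h a \<rho> \<le> weight a * M ^ w"
    using Mem.prems le
    by (auto intro!: Mem.IH[THEN le_mult_power_mono, OF _ assms(1)])
  then have "cost h (Mem a) \<rho> \<le> weight a * M ^ w + M ^ w"
    using one_le_power[OF assms(1), of w] by simp
  also have "\<dots> = weight (Mem a) * M ^ w" by (simp add: algebra_simps)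
  finally show ?case by (simp only: w_def)
next
  case (If_Less a b c d)
  define w where "w = weight (If_Less a b c d)"
  have le: "weight a \<le> w" "weight b \<le> w" "weight c \<le> w" "weight d \<le> w" by (simp_all add: w_def)
  have "cost h a \<rho> \<le> weight a * M ^ w" "cost h b \<rho> \<le> weight b * M ^ w"
    "cost h c \<rho> \<le> weight c * M ^ w" "cost h d \<rho> \<le> weight d * M ^ w"
    using If_Less.prems le
    by (auto intro!: If_Less.IH[THEN le_mult_power_mono, OF _ assms(1)])
  then have "cost h (If_Less a b c d) \<rho> \<le>
      weight a * M ^ w + weight b * M ^ w + weight c * M ^ w + weight d * M ^ w + M ^ w"
    using one_le_power[OF assms(1), of w] by auto
  also have "\<dots> = weight (If_Less a b c d) * M ^ w" by (simp add: algebra_simps)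
  finally show ?case by (simp only: w_def)
next
  case (Sum x z b d e)
  \<comment> \<open>The subexpressions are bounded with exponent \<open>s\<close>, one less than the
    weight of the loop; the spare factor \<open>M\<close> pays for the rounds.\<close>
  define s where "s = weight z + weight b + weight d + weight e + 7"
  have le_s: "weight z \<le> s" "weight b \<le> s" "weight d \<le> s" "weight e \<le> s" by (simp_all add: s_def)
  define w where "w = weight (Sum x z b d e)"
  have w: "w = Suc s" by (simp add: w_def s_def)
  have M1: "1 \<le> M ^ s" using assms(1) by (rule one_le_power)
  have le: "M ^ s \<le> M ^ w" using assms(1) w by (intro power_increasing) auto
  have "cost h (Sum x z b d e) \<rho> \<le> cost h z \<rho> + cost h b \<rho> + 4 +
      eval h b \<rho> * ((weight e + weight d) * M ^ s + 4)"
  proof (rule cost_Sum_le)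
    fix k assume k: "k < eval h b \<rho>"
    let ?\<rho> = "\<rho>(x := ((\<lambda>v. eval h d (\<rho>(x := v))) ^^ k) (eval h z \<rho>))"
    have "cost h e ?\<rho> \<le> weight e * M ^ s" "cost h d ?\<rho> \<le> weight d * M ^ s"
      using Sum.prems k le_s
      by (auto intro!: Sum.IH[THEN le_mult_power_mono, OF _ assms(1)])
    then show "cost h e ?\<rho> + cost h d ?\<rho> \<le> (weight e + weight d) * M ^ s"
      by (simp add: add_mult_distrib)
  qed
  also have "\<dots> \<le> (weight z + weight b) * M ^ s + 4 * M ^ s +
      M * ((weight e + weight d) * M ^ s + 4 * M ^ s)"
  proof (intro add_mono mult_mono)
    show "eval h b \<rho> \<le> M" using Sum.prems by simp
    have "cost h z \<rho> \<le> weight z * M ^ s" "cost h b \<rho> \<le> weight b * M ^ s"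
      using Sum.prems le_s
      by (auto intro!: Sum.IH[THEN le_mult_power_mono, OF _ assms(1)])
    then show "cost h z \<rho> + cost h b \<rho> \<le> (weight z + weight b) * M ^ s"
      by (simp add: add_mult_distrib)
  qed (use M1 in auto)
  also have "\<dots> = (weight z + weight b + 4) * M ^ s + (weight e + weight d + 4) * M ^ w"
    unfolding w power_Suc by (simp add: algebra_simps)
  also have "\<dots> \<le> (weight z + weight b + 4) * M ^ w + (weight e + weight d + 4) * M ^ w"
    using le by (intro add_mono mult_le_mono2) auto
  also have "\<dots> = weight (Sum x z b d e) * M ^ w" by (simp add: algebra_simps)
  finally show ?case by (simp only: w_def)
qed

section \<open>The program\<close>

definition For :: "'v \<Rightarrow> 'v expr \<Rightarrow> 'v expr \<Rightarrow> 'v expr" where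
  "For x b e = Sum x (Lit 0) b (Plus (Var x) (Lit 1)) e"

text \<open>A let-binding, obtained as a loop with a single round.\<close>

definition Bind :: "'v \<Rightarrow> 'v expr \<Rightarrow> 'v expr \<Rightarrow> 'v expr" where
  "Bind x z e = Sum x z (Lit 1) (Var x) e"

definition If_Eq :: "'v expr \<Rightarrow> 'v expr \<Rightarrow> 'v expr \<Rightarrow> 'v expr" where
  "If_Eq a b c = If_Less a b (Lit 0) (If_Less b a (Lit 0) c)"

lemma funpow_Suc_0: "((\<lambda>v. Suc v) ^^ k) 0 = k"
  by (induction k) auto

lemma eval_For [simp]: "eval h (For x b e) \<rho> = (\<Sum>k<eval h b \<rho>. eval h e (\<rho>(x := k)))"
  by (simp add: For_def funpow_Suc_0)

lemma loops_le_For [simp]: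
  "loops_le M h (For x b e) \<rho> \<longleftrightarrow> loops_le M h b \<rho> \<and> eval h b \<rho> \<le> M \<and>
     (\<forall>k<eval h b \<rho>. loops_le M h e (\<rho>(x := k)))"
  by (simp add: For_def funpow_Suc_0)

lemma eval_Bind [simp]: "eval h (Bind x z e) \<rho> = eval h e (\<rho>(x := eval h z \<rho>))"
  by (simp add: Bind_def)

lemma loops_le_Bind [simp]:
  "loops_le M h (Bind x z e) \<rho> \<longleftrightarrow>
     1 \<le> M \<and> loops_le M h z \<rho> \<and> loops_le M h e (\<rho>(x := eval h z \<rho>))"
  by (auto simp: Bind_def)

lemma eval_If_Eq [simp]:
  "eval h (If_Eq a b c) \<rho> = (if eval h a \<rho> = eval h b \<rho> then eval h c \<rho> else 0)"
  by (auto simp: If_Eq_def)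

lemma loops_le_If_Eq [simp]:
  "loops_le M h (If_Eq a b c) \<rho> \<longleftrightarrow> loops_le M h a \<rho> \<and> loops_le M h b \<rho> \<and> loops_le M h c \<rho>"
  by (auto simp: If_Eq_def)

text \<open>\<open>Layer\<close> and \<open>List\<close> hold memory addresses: the start of a
  layer, and the length cell in front of an agent's list. \<open>CodeP\<close> is the candidate,
  \<open>CodeQ\<close> its competitor, and \<open>Code\<close> the argument passed to
  \<open>owner\<close>.\<close>

datatype var =
    Layer | List | Pos | Agent | Item | Code | CodeP | CodeQ | Power | Num | Den | Multiple | Count

abbreviation num_agents :: "var expr" where "num_agents \<equiv> Mem (Lit 0)"
abbreviation num_items :: "var expr" where "num_items \<equiv> Mem (Lit 1)"
abbreviation num_layers :: "var expr" where "num_layers \<equiv> Mem (Lit 2)"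
abbreviation threshold :: "var expr" where "threshold \<equiv> Mem (Lit 3)"

text \<open>A geometric sum: with \<open>n\<close> agents, \<open>(n + 1) ^ e\<close> is 1 plus all
  \<open>n * (n + 1) ^ k\<close> for \<open>k < e\<close>. Products with \<open>n\<close> are loops
  over \<open>Count\<close>.\<close>

definition power_exp :: "var expr \<Rightarrow> var expr" where
  "power_exp e = Plus (Lit 1) (Sum Power (Lit 1) e
     (Plus (Var Power) (For Count num_agents (Var Power))) (For Count num_agents (Var Power)))"

text \<open>Counts the multiples of \<open>Den\<close> that do not exceed \<open>Num\<close>. For
  positive \<open>Den\<close> they are all among the first \<open>Num\<close> positive
  multiples.\<close>

definition quotient :: "var expr" where
  "quotient = Sum Multiple (Var Den) (Var Num) (Plus (Var Multiple) (Var Den))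
     (If_Less (Var Num) (Var Multiple) (Lit 0) (Lit 1))"

text \<open>Digit number \<open>Item\<close> of \<open>Code\<close> in base \<open>n + 1\<close>:
  division by the power gives \<open>q\<close>, and the remainder is
  \<open>q - (q div (n + 1)) * (n + 1)\<close> with the product as a repeated addition.\<close>

definition owner :: "var expr" where
  "owner = Bind Den (power_exp (Var Item)) (Bind Num (Var Code) (Bind Num quotient
     (Bind Den (Plus (Lit 1) num_agents) (Minus (Var Num) (For Count quotient (Var Den))))))"

definition held_exp :: "var expr" where
  "held_exp = For Item num_items (If_Eq owner (Var Agent) (Lit 1))"

definition listing :: "var expr \<Rightarrow> var expr" where
  "listing e = For Pos (Mem (Var List))
     (Bind Item (Mem (Plus (Var List) (Plus (Var Pos) (Lit 1)))) (If_Eq owner (Var Agent) e))"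

definition rank_exp :: "var \<Rightarrow> var expr" where
  "rank_exp x = Bind Code (Var x) (listing (Plus (Var Pos) (Lit 1)))"

text \<open>A loop yields a sum, not the last value of its variable. The address reached after
  \<open>e\<close> lists is therefore rebuilt as the start plus all strides, a stride being the
  length cell and the entries.\<close>

definition skip :: "var expr \<Rightarrow> var expr" where
  "skip e = Plus (Var Layer)
     (Sum List (Var Layer) e (Plus (Var List) (Plus (Lit 1) (Mem (Var List)))) (Plus (Lit 1) (Mem (Var List))))"

text \<open>Counts the agents that hold several items or an unlisted one; the latter shows in fewer
  listed than held items.\<close>

definition illegal :: "var \<Rightarrow> var expr" where
  "illegal x = Bind Code (Var x) (For Agent num_agents (Bind List (skip (Var Agent))
     (If_Less (Lit 1) held_exp (Lit 1) (If_Less (listing (Lit 1)) held_exp (Lit 1) (Lit 0)))))"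

text \<open>By truncated subtraction this vanishes iff no agent has a larger rank under
  \<open>x\<close> than under \<open>y\<close>.\<close>

definition excess :: "var \<Rightarrow> var \<Rightarrow> var expr" where
  "excess x y = For Agent num_agents (Bind List (skip (Var Agent)) (Minus (rank_exp x) (rank_exp y)))"

definition dominated :: "var expr" where
  "dominated = If_Less (Plus (illegal CodeQ) (excess CodeP CodeQ)) (Lit 1)
     (If_Less (Lit 0) (excess CodeQ CodeP) (Lit 1) (Lit 0)) (Lit 0)"

definition optimal :: "var expr" where
  "optimal = If_Less (Lit 0) (illegal CodeP) (Lit 0)
     (If_Less (Lit 0) (For CodeQ (power_exp num_items) dominated) (Lit 0) (Lit 1))"

text \<open>The lists start at address 4, after the header. \<open>skip num_agents\<close> leads
  from one layer to the next, so a single walk visits all layers.\<close>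

definition optimal_layers :: "var expr" where
  "optimal_layers = Sum Layer (Lit 4) num_layers (skip num_agents) optimal"

definition answer :: "var expr" where
  "answer = If_Less (Lit 0) num_agents (If_Less (Lit 0) num_items
     (If_Less (Lit 0) (For CodeP (power_exp num_items) (If_Less optimal_layers threshold (Lit 0) (Lit 1)))
        (Lit 1) (Lit 0)) (Lit 1)) (Lit 1)"

section \<open>Powers, quotients and digits as sums\<close>

definition digit :: "nat \<Rightarrow> nat \<Rightarrow> nat \<Rightarrow> nat" where
  "digit b v i = v div b ^ i mod b"

definition advance :: "(nat \<Rightarrow> nat) \<Rightarrow> nat \<Rightarrow> nat" where
  "advance h x = x + 1 + h x"

lemma funpow_mult_add: "((\<lambda>v. v + c * v) ^^ k) (Suc 0) = (c + 1) ^ k" for c :: nat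
  by (induction k) auto

lemma geometric_sum: "Suc (\<Sum>k<e. c * (c + 1) ^ k) = (c + 1) ^ e" for c :: nat
  by (induction e) auto

lemma eval_power_exp [simp]: "eval h (power_exp e) \<rho> = (h 0 + 1) ^ eval h e \<rho>"
  using geometric_sum[of "h 0" "eval h e \<rho>"] by (simp add: power_exp_def funpow_mult_add)

lemma loops_le_power_exp [simp]:
  "h 0 \<le> M \<Longrightarrow> loops_le M h (power_exp e) \<rho> \<longleftrightarrow> loops_le M h e \<rho> \<and> eval h e \<rho> \<le> M"
  by (auto simp: power_exp_def)

lemma funpow_add_self: "((\<lambda>v. v + d) ^^ k) d = Suc k * d" for d :: nat
  by (induction k) auto

lemma sum_multiples:
  fixes d :: nat
  assumes "0 < d"
  shows "(\<Sum>k<w. if w < Suc k * d then 0 else 1) = w div d"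
proof -
  have "w < Suc k * d \<longleftrightarrow> w div d \<le> k" for k
    using less_eq_div_iff_mult_less_eq[OF assms, of "Suc k" w] by linarith
  then have "(\<Sum>k<w. if w < Suc k * d then 0 else 1) = (\<Sum>k<w. if w div d \<le> k then 0 else 1 :: nat)"
    by (simp del: mult_Suc)
  also have "\<dots> = (\<Sum>k<w div d. 1)"
    \<comment> \<open>The nonzero terms are those with \<open>k < w div d\<close>; as
      \<open>w div d \<le> w\<close>, the longer sum contains them all.\<close>
    by (rule sum.mono_neutral_cong_right) (auto dest: less_le_trans[OF _ div_le_dividend])
  finally show ?thesis by simp
qed

lemma eval_quotient: "0 < \<rho> Den \<Longrightarrow> eval h quotient \<rho> = \<rho> Num div \<rho> Den"
  using sum_multiples[of "\<rho> Den" "\<rho> Num"] by (simp add: quotient_def funpow_add_self cong: if_cong del: mult_Suc)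

lemma loops_le_quotient [simp]: "loops_le M h quotient \<rho> \<longleftrightarrow> \<rho> Num \<le> M"
  by (auto simp: quotient_def)

lemma eval_owner [simp]: "eval h owner \<rho> = digit (h 0 + 1) (\<rho> Code) (\<rho> Item)"
  by (simp add: owner_def eval_quotient digit_def minus_div_mult_eq_mod del: mult_Suc mult_Suc_right)

lemma loops_le_owner:
  "h 0 \<le> M \<Longrightarrow> \<rho> Code \<le> M \<Longrightarrow> \<rho> Item \<le> M \<Longrightarrow> 1 \<le> M \<Longrightarrow> loops_le M h owner \<rho>"
  by (auto simp: owner_def eval_quotient intro: order_trans[OF div_le_dividend])

lemma funpow_advance: "x + (\<Sum>k<e. Suc (h ((advance h ^^ k) x))) = (advance h ^^ e) x"
  by (induction e) (auto simp: advance_def)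

lemma eval_skip [simp]: "eval h (skip e) \<rho> = (advance h ^^ eval h e \<rho>) (\<rho> Layer)"
  using funpow_advance[of "\<rho> Layer" h "eval h e \<rho>"]
  by (simp add: skip_def advance_def[abs_def])

lemma loops_le_skip [simp]: "loops_le M h (skip e) \<rho> \<longleftrightarrow> loops_le M h e \<rho> \<and> eval h e \<rho> \<le> M"
  by (auto simp: skip_def)

section \<open>Codes of assignments\<close>

text \<open>A number below \<open>(n + 1) ^ m\<close> codes the map sending item \<open>i\<close> to the agent given by
  digit \<open>i\<close> in base \<open>n + 1\<close>, where the digit \<open>n\<close> means that the item is not assigned.\<close>

definition held :: "nat \<Rightarrow> nat \<Rightarrow> nat \<Rightarrow> nat \<Rightarrow> nat" where
  "held n m v a = (\<Sum>i<m. if digit (n + 1) v i = a then 1 else 0)"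

definition listed :: "nat \<Rightarrow> nat list \<Rightarrow> nat \<Rightarrow> nat \<Rightarrow> nat" where
  "listed n xs v a = (\<Sum>k<length xs. if digit (n + 1) v (xs ! k) = a then 1 else 0)"

text \<open>For an agent whose only item is on its duplicate-free list, the position counted from 1.
  Holding nothing gives 0, below every listed item, so numerical order mirrors preference.\<close>

definition rank :: "nat \<Rightarrow> nat list \<Rightarrow> nat \<Rightarrow> nat \<Rightarrow> nat" where
  "rank n xs v a = (\<Sum>k<length xs. if digit (n + 1) v (xs ! k) = a then k + 1 else 0)"

text \<open>Legality in terms of counts a machine can compute: for at most one held item,
  \<open>held \<le> listed\<close> means that the item, if any, is on the list.\<close>

definition legal_code :: "nat \<Rightarrow> nat \<Rightarrow> (nat \<Rightarrow> nat list) \<Rightarrow> nat \<Rightarrow> bool" where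
  "legal_code n m L v \<longleftrightarrow> (\<forall>a<n. held n m v a \<le> 1 \<and> held n m v a \<le> listed n (L a) v a)"

definition dominated_code :: "nat \<Rightarrow> nat \<Rightarrow> (nat \<Rightarrow> nat list) \<Rightarrow> nat \<Rightarrow> nat \<Rightarrow> bool" where
  "dominated_code n m L v w \<longleftrightarrow> legal_code n m L w \<and>
     (\<forall>a<n. rank n (L a) v a \<le> rank n (L a) w a) \<and>
     (\<exists>a<n. rank n (L a) v a < rank n (L a) w a)"

definition optimal_code :: "nat \<Rightarrow> nat \<Rightarrow> (nat \<Rightarrow> nat list) \<Rightarrow> nat \<Rightarrow> bool" where
  "optimal_code n m L v \<longleftrightarrow> legal_code n m L v \<and> \<not> (\<exists>w<(n + 1) ^ m. dominated_code n m L v w)"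

section \<open>Lists in memory and walks along them\<close>

definition list_at :: "(nat \<Rightarrow> nat) \<Rightarrow> nat \<Rightarrow> nat list \<Rightarrow> bool" where
  "list_at h x ys \<longleftrightarrow> (\<forall>k<length ys. h (x + k) = ys ! k)"

lemma list_at_Cons: "list_at h x (y # ys) \<longleftrightarrow> h x = y \<and> list_at h (Suc x) ys"
  unfolding list_at_def by (auto simp: nth_Cons less_Suc_eq_0_disj split: nat.split)

lemma list_at_append: "list_at h x (ys @ zs) \<longleftrightarrow> list_at h x ys \<and> list_at h (x + length ys) zs"
  by (induction ys arbitrary: x) (auto simp: list_at_Cons, auto simp: list_at_def)

definition block :: "(nat \<Rightarrow> nat list) \<Rightarrow> nat \<Rightarrow> nat list" where
  "block L n = concat (map (\<lambda>a. length (L a) # L a) [0..<n])"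

text \<open>The step \<open>g\<close> is arbitrary because walks occur on two levels, over the lists
  of a layer and over the layers. A step is known to be correct only where the block
  \<open>f k\<close> is present in memory.\<close>

lemma funpow_concat:
  assumes "list_at h x (concat (map f [0..<n]))"
    "\<And>k y. k < n \<Longrightarrow> list_at h y (f k) \<Longrightarrow> g y = y + length (f k)"
  shows "(g ^^ n) x = x + length (concat (map f [0..<n]))"
  using assms
proof (induction n)
  case (Suc n)
  have "(g ^^ n) x = x + length (concat (map f [0..<n]))"
    using Suc by (simp add: list_at_append)
  then show ?case using Suc.prems(1) Suc.prems(2)[of n] by (simp add: list_at_append)
qed simp

lemma list_at_funpow:
  assumes "list_at h x (concat (map f [0..<n]))"
    "\<And>k y. k < n \<Longrightarrow> list_at h y (f k) \<Longrightarrow> g y = y + length (f k)" "k < n"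
  shows "list_at h ((g ^^ k) x) (f k)"
  using assms
proof (induction n)
  case (Suc n)
  show ?case
  proof (cases "k = n")
    case True
    moreover have "(g ^^ n) x = x + length (concat (map f [0..<n]))"
      using Suc.prems by (intro funpow_concat[of h]) (auto simp: list_at_append)
    ultimately show ?thesis using Suc.prems(1) by (simp add: list_at_append)
  next
    case False
    then show ?thesis using Suc by (simp add: list_at_append)
  qed
qed simp

lemma funpow_advance_block: "list_at h x (block L n) \<Longrightarrow> (advance h ^^ n) x = x + length (block L n)"
  unfolding block_def by (rule funpow_concat) (auto simp: list_at_Cons advance_def)

lemma list_at_funpow_advance:
  "list_at h x (block L n) \<Longrightarrow> a < n \<Longrightarrow> list_at h ((advance h ^^ a) x) (length (L a) # L a)"
  unfolding block_def by (rule list_at_funpow) (auto simp: list_at_Cons advance_def)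

section \<open>The optimality test in a single layer\<close>

lemma sum_diff_nat_pos_iff: "0 < (\<Sum>a<n. f a - g a) \<longleftrightarrow> (\<exists>a<n. g a < f a)"
  for f g :: "nat \<Rightarrow> nat"
  by (induction n) (auto simp: less_Suc_eq)

lemma sum_of_bool_pos_iff: "0 < (\<Sum>w<n. of_bool (P w) :: nat) \<longleftrightarrow> (\<exists>w<n. P w)" for n :: nat
  by (induction n) (auto simp: less_Suc_eq)

lemma sum_if_less_pos_iff:
  "0 < (\<Sum>v<n. if f v < a then 0 else Suc 0) \<longleftrightarrow> (\<exists>v<n. a \<le> f v)" for n :: nat and f :: "nat \<Rightarrow> nat"
  by (induction n) (auto simp: less_Suc_eq)

text \<open>Isolates the layer stored at address \<open>x\<close>, so that the test is verified once
  and then instantiated for every layer.\<close>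

locale layer_memory =
  fixes h :: "nat \<Rightarrow> nat" and n m x :: nat and L :: "nat \<Rightarrow> nat list"
  assumes counts: "h 0 = n" "h (Suc 0) = m" "0 < n" "0 < m"
    and lists: "list_at h x (block L n)"
    and list_items: "\<And>a. a < n \<Longrightarrow> set (L a) \<subseteq> {..<m}" "\<And>a. a < n \<Longrightarrow> distinct (L a)"
begin

abbreviation N :: nat where "N \<equiv> Suc n ^ m"

text \<open>Together with \<open>items_le\<close> this makes \<open>N\<close> a common bound for all
  loops of the test. It rests on \<open>0 < m\<close>, while \<open>items_le\<close> rests on
  \<open>0 < n\<close> through \<open>m < 2 ^ m\<close>.\<close>

lemma agents_le: "n \<le> N"
  using self_le_power[of "Suc n" m] counts by simp

lemma items_le: "m \<le> N"
  using less_exp[of m] power_mono[of 2 "Suc n" m] counts by simp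

lemma item_le: "i < m \<Longrightarrow> i \<le> N"
  using items_le by simp

lemma head: "a < n \<Longrightarrow> h ((advance h ^^ a) x) = length (L a)"
  using list_at_funpow_advance[OF lists] by (simp add: list_at_Cons)

lemma entry:
  assumes "a < n" "k < length (L a)"
  shows "h (Suc ((advance h ^^ a) x + k)) = L a ! k"
proof -
  have "list_at h (Suc ((advance h ^^ a) x)) (L a)"
    using list_at_funpow_advance[OF lists assms(1)] by (simp add: list_at_Cons)
  then show ?thesis using assms(2) by (simp add: list_at_def)
qed

lemma length_le:
  assumes "a < n"
  shows "length (L a) \<le> N"
proof -
  have "length (L a) = card (set (L a))" using list_items(2)[OF assms] by (simp add: distinct_card)
  also have "\<dots> \<le> card {..<m}" using list_items(1)[OF assms] by (intro card_mono) auto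
  finally show ?thesis using items_le by simp
qed

lemma entry_le:
  assumes "a < n" "k < length (L a)"
  shows "L a ! k \<le> N"
  using list_items(1)[OF assms(1)] nth_mem[OF assms(2)] items_le by (fastforce simp: subset_eq)

lemma eval_held: "\<rho> Agent = a \<Longrightarrow> eval h held_exp \<rho> = held n m (\<rho> Code) a"
  by (simp add: held_exp_def held_def counts cong: if_cong)

lemma eval_listing:
  assumes "a < n" "\<rho> List = (advance h ^^ a) x" "\<rho> Agent = a"
  shows "eval h (listing (Lit 1)) \<rho> = listed n (L a) (\<rho> Code) a"
    "eval h (listing (Plus (Var Pos) (Lit 1))) \<rho> = rank n (L a) (\<rho> Code) a"
  using assms by (auto simp: listing_def listed_def rank_def counts head entry
      intro!: sum.cong cong: if_cong)

lemma eval_illegal: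
  assumes "\<rho> Layer = x"
  shows "eval h (illegal y) \<rho> = 0 \<longleftrightarrow> legal_code n m L (\<rho> y)"
  using assms
  by (auto simp: illegal_def legal_code_def counts eval_held eval_listing[unfolded One_nat_def]
      not_less cong: if_cong split: if_splits)

lemma eval_excess:
  assumes "\<rho> Layer = x" "y \<in> {CodeP, CodeQ}" "z \<in> {CodeP, CodeQ}"
  shows "eval h (excess y z) \<rho> = (\<Sum>a<n. rank n (L a) (\<rho> y) a - rank n (L a) (\<rho> z) a)"
  using assms
  by (auto simp: excess_def rank_exp_def counts eval_listing[unfolded One_nat_def])

lemma eval_dominated:
  assumes "\<rho> Layer = x"
  shows "eval h dominated \<rho> = of_bool (dominated_code n m L (\<rho> CodeP) (\<rho> CodeQ))"
proof -
  \<comment> \<open>Complements \<open>sum_diff_nat_pos_iff\<close>: a zero \<open>excess\<close> is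
    the weak comparison for all agents, a positive one the strict comparison for some agent.\<close>
  have "(\<Sum>a<n. f a - g a) = 0 \<longleftrightarrow> (\<forall>a<n. f a \<le> g a)" for f g :: "nat \<Rightarrow> nat"
    using sum_diff_nat_pos_iff[of f g n] by (metis neq0_conv not_le)
  then show ?thesis
    using assms unfolding dominated_def dominated_code_def
    by (simp add: eval_illegal eval_excess sum_diff_nat_pos_iff del: sum_eq_0_iff)
qed

lemma eval_optimal:
  assumes "\<rho> Layer = x"
  shows "eval h optimal \<rho> = of_bool (optimal_code n m L (\<rho> CodeP))"
  using assms unfolding optimal_def optimal_code_def
  by (simp add: eval_illegal eval_dominated counts sum_of_bool_pos_iff neq0_conv[symmetric]
      del: sum_of_bool_eq neq0_conv cong: if_cong) blast

lemma loops_le_listing: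
  assumes "a < n" "\<rho> List = (advance h ^^ a) x" "\<rho> Code \<le> N"
    "e \<in> {Lit (Suc 0), Plus (Var Pos) (Lit (Suc 0))}"
  shows "loops_le N h (listing e) \<rho>"
  using assms agents_le length_le entry_le
  by (auto simp: listing_def counts head entry intro!: loops_le_owner)

lemma loops_le_illegal:
  assumes "\<rho> Layer = x" "\<rho> y \<le> N"
  shows "loops_le N h (illegal y) \<rho>"
  using assms agents_le items_le
  by (auto simp: illegal_def held_exp_def counts item_le intro!: loops_le_owner loops_le_listing)

lemma loops_le_excess:
  assumes "\<rho> Layer = x" "y \<in> {CodeP, CodeQ}" "z \<in> {CodeP, CodeQ}" "\<rho> y \<le> N" "\<rho> z \<le> N"
  shows "loops_le N h (excess y z) \<rho>"
  using assms agents_le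
  by (auto simp: excess_def rank_exp_def counts intro!: loops_le_listing)

lemma loops_le_optimal:
  assumes "\<rho> Layer = x" "\<rho> CodeP \<le> N"
  shows "loops_le N h optimal \<rho>"
  using assms agents_le items_le
  by (auto simp: optimal_def dominated_def counts intro!: loops_le_illegal loops_le_excess)

end

section \<open>Numbers as codes of assignments\<close>

lemma ex_digits: "(\<And>i. i < m \<Longrightarrow> f i < b) \<Longrightarrow> \<exists>v<b ^ m. \<forall>i<m. digit b v i = f i"
proof (induction m arbitrary: f)
  case (Suc m)
  obtain v where v: "v < b ^ m" "\<And>i. i < m \<Longrightarrow> digit b v i = f (Suc i)"
    using Suc.IH[of "\<lambda>i. f (Suc i)"] Suc.prems by auto
  have f0: "f 0 < b" using Suc.prems by simp
  \<comment> \<open>Horner step: \<open>v\<close> codes the shifted sequence and \<open>f 0\<close>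
    becomes the lowest digit. \<open>Suc v \<le> b ^ m\<close> keeps the result below
    \<open>b ^ Suc m\<close>.\<close>
  have "f 0 + b * v < b + b * v" using f0 by simp
  also have "\<dots> = b * Suc v" by simp
  also have "\<dots> \<le> b ^ Suc m" using v(1) by (simp del: mult_Suc_right add: Suc_le_eq)
  finally have "f 0 + b * v < b ^ Suc m" .
  moreover have "digit b (f 0 + b * v) i = f i" if "i < Suc m" for i
  proof (cases i)
    case 0
    then show ?thesis using f0 by (simp add: digit_def)
  next
    case (Suc i')
    then have "digit b (f 0 + b * v) i = digit b v i'"
      using f0 by (simp add: digit_def div_mult2_eq)
    then show ?thesis using v(2) Suc that by simp
  qed
  ultimately show ?case by blast
qed simp

text \<open>A relation, since a number in which an agent owns two items codes no assignment. Only
  \<open>a < n\<close> is constrained, which leaves the digit \<open>n\<close> free to mark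
  unassigned items.\<close>

definition codes :: "nat \<Rightarrow> nat \<Rightarrow> nat \<Rightarrow> (nat \<Rightarrow> nat option) \<Rightarrow> bool" where
  "codes n m v p \<longleftrightarrow> (\<forall>a<n. p a \<in> insert None (Some ` {..<m})) \<and>
     (\<forall>i<m. \<forall>a<n. digit (n + 1) v i = a \<longleftrightarrow> p a = Some i)"

lemma codes_digit_iff: "codes n m v p \<Longrightarrow> i < m \<Longrightarrow> a < n \<Longrightarrow> digit (Suc n) v i = a \<longleftrightarrow> p a = Some i"
  by (simp add: codes_def)

lemma held_codes:
  assumes "codes n m v p" "a < n"
  shows "held n m v a = of_bool (p a \<noteq> None)"
proof -
  have "held n m v a = (\<Sum>i<m. if p a = Some i then 1 else 0)"
    unfolding held_def by (rule sum.cong) (use codes_digit_iff[OF assms(1) _ assms(2)] in auto)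
  moreover have "p a = None \<or> (\<exists>i<m. p a = Some i)" using assms by (auto simp: codes_def)
  ultimately show ?thesis by auto
qed

lemma listed_rank_codes:
  assumes "codes n m v p" "a < n" "set xs \<subseteq> {..<m}" "distinct xs"
  shows "p a \<notin> Some ` set xs \<Longrightarrow> listed n xs v a = 0"
    "p a \<notin> Some ` set xs \<Longrightarrow> rank n xs v a = 0"
    "k < length xs \<Longrightarrow> p a = Some (xs ! k) \<Longrightarrow> listed n xs v a = 1"
    "k < length xs \<Longrightarrow> p a = Some (xs ! k) \<Longrightarrow> rank n xs v a = Suc k"
proof -
  have *: "digit (Suc n) v (xs ! j) = a \<longleftrightarrow> p a = Some (xs ! j)" if "j < length xs" for j
    using nth_mem[OF that] assms by (intro codes_digit_iff) auto
  show "listed n xs v a = 0" "rank n xs v a = 0" if "p a \<notin> Some ` set xs"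
    using that * nth_mem[of _ xs] by (fastforce simp: listed_def rank_def)+
  assume k: "k < length xs" "p a = Some (xs ! k)"
  \<comment> \<open>By distinctness only position \<open>k\<close> contributes to the two
    sums.\<close>
  have **: "digit (Suc n) v (xs ! j) = a \<longleftrightarrow> k = j" if "j < length xs" for j
    using k that assms(4) * by (auto simp: nth_eq_iff_index_eq)
  have "listed n xs v a = (\<Sum>j<length xs. if k = j then 1 else 0)"
    "rank n xs v a = (\<Sum>j<length xs. if k = j then j + 1 else 0)"
    unfolding listed_def rank_def by (auto intro!: sum.cong simp: **)
  then show "listed n xs v a = 1" "rank n xs v a = Suc k" using k by simp_all
qed

locale goa_numbered =
  fixes inst :: "(nat, nat) goa" and n m :: nat
  assumes inst: "goa_instance inst" and agents: "agents inst = {..<n}" and items: "items inst = {..<m}"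
begin

lemma codes_assignment: "codes n m v p \<Longrightarrow> assignment inst p"
  unfolding codes_def assignment_def agents items by (metis imageE insertE lessThan_iff)

lemma ex_code:
  assumes "assignment inst p"
  shows "\<exists>v<(n + 1) ^ m. codes n m v p"
proof -
  \<comment> \<open>The owner of item \<open>i\<close>, or the spare digit \<open>n\<close> if there
    is none. \<open>THE\<close> is well defined because no two agents share an item.\<close>
  define f where "f i = (if \<exists>a<n. p a = Some i then THE a. a < n \<and> p a = Some i else n)" for i
  have unique: "a = b" if "a < n" "b < n" "p a = Some i" "p b = Some i" for a b i
    using assms that unfolding assignment_def agents by (metis lessThan_iff option.distinct(1))
  have f: "f i = a \<longleftrightarrow> p a = Some i" if "a < n" for a i
  proof
    assume "f i = a"
    then have "\<exists>a<n. p a = Some i" "(THE a. a < n \<and> p a = Some i) = a"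
      using that unfolding f_def by (auto split: if_splits)
    then show "p a = Some i"
      using theI'[of "\<lambda>a. a < n \<and> p a = Some i"] unique by blast
  next
    assume "p a = Some i"
    then show "f i = a"
      using that unique unfolding f_def by (auto intro!: the_equality)
  qed
  have "f i < n + 1" for i
  proof (cases "\<exists>a<n. p a = Some i")
    case True
    then show ?thesis using f by fastforce
  next
    case False
    then have "f i = n" unfolding f_def by (rule if_not_P)
    then show ?thesis by simp
  qed
  then obtain v where "v < (n + 1) ^ m" "\<forall>i<m. digit (n + 1) v i = f i"
    using ex_digits[of m f "n + 1"] by blast
  moreover have "p a \<in> insert None (Some ` {..<m})" if "a < n" for a
    using assms that unfolding assignment_def agents items by blast
  ultimately show ?thesis using f unfolding codes_def by metis
qed

text \<open>The bound \<open>held \<le> 1\<close> leaves every agent at most one item, which then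
  determines \<open>p\<close>.\<close>

lemma ex_codes:
  assumes "legal_code n m L v"
  shows "\<exists>p. codes n m v p"
proof -
  have unique: "i = j" if "a < n" "i < m" "j < m" "digit (n + 1) v i = a" "digit (n + 1) v j = a" for a i j
  proof (rule ccontr)
    assume "i \<noteq> j"
    \<comment> \<open>Two different items of \<open>a\<close> would already contribute 2 to
      \<open>held\<close>.\<close>
    have "(\<Sum>k\<in>{i, j}. if digit (n + 1) v k = a then 1 else 0) \<le> held n m v a"
      unfolding held_def by (rule sum_mono2) (use that in auto)
    moreover have "held n m v a \<le> 1" using assms that(1) by (auto simp: legal_code_def)
    ultimately show False using that \<open>i \<noteq> j\<close> by simp
  qed
  define p where "p a = (if \<exists>i<m. digit (n + 1) v i = a
    then Some (SOME i. i < m \<and> digit (n + 1) v i = a) else None)" for a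
  have p: "p a = None \<and> \<not> (\<exists>i<m. digit (n + 1) v i = a) \<or>
      (\<exists>i<m. p a = Some i \<and> digit (n + 1) v i = a)" for a
    using someI_ex[of "\<lambda>i. i < m \<and> digit (n + 1) v i = a"] unfolding p_def by auto
  have "p a \<in> insert None (Some ` {..<m})" for a using p[of a] by auto
  moreover have "digit (n + 1) v i = a \<longleftrightarrow> p a = Some i" if "i < m" "a < n" for i a
    using p[of a] unique[OF that(2)] that(1) by (metis option.inject option.distinct(1))
  ultimately show ?thesis unfolding codes_def by blast
qed

lemma pref_list:
  assumes "j \<in> {1..layers inst}" "a < n"
  shows "set (pref_list inst j a) = acceptable inst j a"
    "sorted_wrt (\<lambda>x y. (x, y) \<in> pref inst j a) (pref_list inst j a)"
    "set (pref_list inst j a) \<subseteq> {..<m}"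
    "distinct (pref_list inst j a)"
    "\<And>i k. i < length (pref_list inst j a) \<Longrightarrow> k < length (pref_list inst j a) \<Longrightarrow>
       (pref_list inst j a ! i, pref_list inst j a ! k) \<in> pref inst j a \<longleftrightarrow> i < k"
proof -
  let ?xs = "pref_list inst j a"
  show set: "set ?xs = acceptable inst j a"
    and sorted: "sorted_wrt (\<lambda>x y. (x, y) \<in> pref inst j a) ?xs"
    using theI'[OF ex1_pref_list[OF inst assms(1), of a]] assms(2)
    unfolding pref_list_def agents by auto
  show "set ?xs \<subseteq> {..<m}"
    using inst assms unfolding set goa_instance_def agents items by blast
  have order: "trans (pref inst j a)" "irrefl (pref inst j a)"
    using inst assms unfolding goa_instance_def strict_linear_order_on_def agents by auto
  have less: "(?xs ! i, ?xs ! k) \<in> pref inst j a" if "i < k" "k < length ?xs" for i k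
    using sorted_wrt_nth_less[OF sorted that] .
  then show "distinct ?xs"
    using order(2) unfolding distinct_conv_nth irrefl_def by (metis nat_neq_iff)
  show "(?xs ! i, ?xs ! k) \<in> pref inst j a \<longleftrightarrow> i < k"
    if "i < length ?xs" "k < length ?xs" for i k
    using less that order unfolding irrefl_def by (metis nat_neq_iff transD)
qed

text \<open>If the held item is on the list, both counts are 1. Otherwise \<open>listed\<close> is
  0, and the inequality forces \<open>held\<close> to be 0, that is,
  \<open>p a = None\<close>.\<close>

lemma legal_code_iff:
  assumes "j \<in> {1..layers inst}" "codes n m v p"
  shows "legal_code n m (pref_list inst j) v \<longleftrightarrow> legal inst j p"
proof -
  have "held n m v a \<le> 1 \<and> held n m v a \<le> listed n (pref_list inst j a) v a \<longleftrightarrow>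
      p a \<in> insert None (Some ` acceptable inst j a)" if a: "a < n" for a
  proof (cases "p a \<in> Some ` set (pref_list inst j a)")
    case True
    then obtain k where "k < length (pref_list inst j a)" "p a = Some (pref_list inst j a ! k)"
      by (auto simp: in_set_conv_nth)
    then show ?thesis
      using listed_rank_codes(3)[OF assms(2) a pref_list(3,4)[OF assms(1) a]] True
      by (simp add: held_codes[OF assms(2) a] pref_list(1)[OF assms(1) a])
  next
    case False
    then show ?thesis
      using listed_rank_codes(1)[OF assms(2) a pref_list(3,4)[OF assms(1) a]]
      by (simp add: held_codes[OF assms(2) a] pref_list(1)[OF assms(1) a])
  qed
  then show ?thesis
    using codes_assignment[OF assms(2)] by (auto simp: legal_code_def legal_def agents)
qed

text \<open>Legality leaves two options per agent: \<open>None\<close> with rank 0, or the list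
  entry at \<open>k\<close> with rank \<open>Suc k\<close>. Lists ascend from the least to the most
  preferred item, so ranks compare as preferences do.\<close>

lemma rank_iff:
  assumes j: "j \<in> {1..layers inst}" and a: "a < n" and vp: "codes n m v p" and wq: "codes n m w q"
    and legal: "legal inst j p" "legal inst j q"
  shows "rank n (pref_list inst j a) v a < rank n (pref_list inst j a) w a \<longleftrightarrow> prefers inst j a (p a) (q a)"
    "rank n (pref_list inst j a) v a \<le> rank n (pref_list inst j a) w a \<longleftrightarrow>
       weakly_prefers inst j a (p a) (q a)"
proof -
  let ?xs = "pref_list inst j a"
  note L = pref_list[OF j a]
  have cases: "p a = None \<and> rank n ?xs v a = 0 \<or>
      (\<exists>k<length ?xs. p a = Some (?xs ! k) \<and> rank n ?xs v a = Suc k)"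
    if "codes n m v p" "legal inst j p" for v p
  proof (cases "p a")
    case None
    then show ?thesis using listed_rank_codes(2)[OF that(1) a L(3,4)] by auto
  next
    case (Some x)
    have "p a \<in> insert None (Some ` acceptable inst j a)"
      using that(2) a by (simp only: legal_def agents lessThan_iff Ball_def)
    then have "x \<in> set ?xs" unfolding Some L(1) by (elim insertE imageE) simp_all
    then obtain k where "k < length ?xs" "x = ?xs ! k" by (metis in_set_conv_nth)
    then show ?thesis using Some listed_rank_codes(4)[OF that(1) a L(3,4)] by metis
  qed
  have acc: "k < length ?xs \<Longrightarrow> ?xs ! k \<in> acceptable inst j a" for k
    using nth_mem[of k ?xs] unfolding L(1) .
  show "rank n ?xs v a < rank n ?xs w a \<longleftrightarrow> prefers inst j a (p a) (q a)"
    "rank n ?xs v a \<le> rank n ?xs w a \<longleftrightarrow> weakly_prefers inst j a (p a) (q a)"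
    using cases[OF vp legal(1)] cases[OF wq legal(2)]
    by (elim disjE exE conjE;
        simp add: weakly_prefers_def L(5) acc nth_eq_iff_index_eq[OF L(4)] le_less disj_commute)+
qed

text \<open>Competitors correspond: a dominating code is legal and hence codes some
  \<open>q\<close>, and every legal \<open>q\<close> has a code below the bound. The case split
  supplies the legality of \<open>p\<close> that \<open>rank_iff\<close> requires.\<close>

lemma optimal_code_iff:
  assumes j: "j \<in> {1..layers inst}" and vp: "codes n m v p"
  shows "optimal_code n m (pref_list inst j) v \<longleftrightarrow> pareto_optimal inst j p"
proof (cases "legal inst j p")
  case True
  have dom: "dominated_code n m (pref_list inst j) v w \<longleftrightarrow> legal inst j q \<and>
      (\<forall>a\<in>agents inst. weakly_prefers inst j a (p a) (q a)) \<and>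
      (\<exists>a\<in>agents inst. prefers inst j a (p a) (q a))" if "codes n m w q" for w q
    using rank_iff[OF j _ vp that True] legal_code_iff[OF j that]
    unfolding dominated_code_def agents by auto
  have "(\<exists>w<(n + 1) ^ m. dominated_code n m (pref_list inst j) v w) \<longleftrightarrow>
      (\<exists>q. legal inst j q \<and> (\<forall>a\<in>agents inst. weakly_prefers inst j a (p a) (q a)) \<and>
        (\<exists>a\<in>agents inst. prefers inst j a (p a) (q a)))" (is "?l \<longleftrightarrow> ?r")
  proof
    assume ?l
    then obtain w where w: "dominated_code n m (pref_list inst j) v w" by blast
    then have "legal_code n m (pref_list inst j) w" by (simp add: dominated_code_def)
    then obtain q where "codes n m w q" using ex_codes by blast
    then show ?r using dom w by blast
  next
    assume ?r
    then obtain q where q: "legal inst j q"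
      "(\<forall>a\<in>agents inst. weakly_prefers inst j a (p a) (q a)) \<and>
        (\<exists>a\<in>agents inst. prefers inst j a (p a) (q a))" by blast
    have "assignment inst q" using q(1) by (simp add: legal_def)
    then obtain w where "w < (n + 1) ^ m" "codes n m w q" using ex_code by blast
    then show ?l using dom q by blast
  qed
  then show ?thesis
    using True legal_code_iff[OF j vp] unfolding optimal_code_def pareto_optimal_def by blast
next
  case False
  then show ?thesis
    using legal_code_iff[OF j vp] unfolding optimal_code_def pareto_optimal_def by blast
qed

lemma goa_yes_iff:
  "goa_yes inst \<longleftrightarrow> (\<exists>v<(n + 1) ^ m.
     alpha inst \<le> card {j \<in> {1..layers inst}. optimal_code n m (pref_list inst j) v})"
proof
  assume "goa_yes inst"
  then obtain p J where p: "assignment inst p" "J \<subseteq> {1..layers inst}" "card J = alpha inst"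
    "\<forall>j\<in>J. pareto_optimal inst j p"
    unfolding goa_yes_def globally_optimal_def by blast
  then obtain v where v: "v < (n + 1) ^ m" "codes n m v p" using ex_code by blast
  then have "J \<subseteq> {j \<in> {1..layers inst}. optimal_code n m (pref_list inst j) v}"
    using p optimal_code_iff by blast
  then have "alpha inst \<le> card {j \<in> {1..layers inst}. optimal_code n m (pref_list inst j) v}"
    using p(3) card_mono[of "{j \<in> {1..layers inst}. optimal_code n m (pref_list inst j) v}" J] by simp
  then show "\<exists>v<(n + 1) ^ m.
     alpha inst \<le> card {j \<in> {1..layers inst}. optimal_code n m (pref_list inst j) v}"
    using v(1) by blast
next
  assume "\<exists>v<(n + 1) ^ m.
     alpha inst \<le> card {j \<in> {1..layers inst}. optimal_code n m (pref_list inst j) v}"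
  then obtain v J where J: "J \<subseteq> {j \<in> {1..layers inst}. optimal_code n m (pref_list inst j) v}"
    "card J = alpha inst" by (meson obtain_subset_with_card_n)
  \<comment> \<open>Since \<open>alpha\<close> is at least 1, \<open>v\<close> is legal in some
    layer; this is what makes \<open>v\<close> the code of an assignment.\<close>
  have "J \<noteq> {}" using J(2) inst by (auto simp: goa_instance_def)
  then obtain j where "optimal_code n m (pref_list inst j) v" using J(1) by blast
  then have "legal_code n m (pref_list inst j) v" by (simp add: optimal_code_def)
  then obtain p where p: "codes n m v p" using ex_codes by blast
  then have "\<forall>j\<in>J. pareto_optimal inst j p" using J(1) optimal_code_iff by blast
  then show "goa_yes inst"
    using J codes_assignment[OF p] unfolding goa_yes_def globally_optimal_def by blast
qed

section \<open>The encoded instance in memory\<close>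

abbreviation memory :: "nat \<Rightarrow> nat" where
  "memory \<equiv> snd (input_state (encode inst))"

lemma list_at_memory:
  "list_at memory 4 (concat (map (\<lambda>k. block (pref_list inst (Suc k)) n) [0..<layers inst]))"
proof -
  have "list_at memory 0 (encode inst)"
    by (simp add: list_at_def input_state_def)
  \<comment> \<open>Layers are renumbered from 0 to match the rounds of the loop.\<close>
  moreover have "encode inst = [n, m, layers inst, alpha inst] @
      concat (map (\<lambda>k. block (pref_list inst (Suc k)) n) [0..<layers inst])"
    unfolding encode_def agents items block_def
    by (simp only: One_nat_def map_Suc_upt[symmetric] map_map comp_def card_lessThan)
  ultimately have "list_at memory 0 ([n, m, layers inst, alpha inst] @
      concat (map (\<lambda>k. block (pref_list inst (Suc k)) n) [0..<layers inst]))"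
    by simp
  then have "list_at memory (0 + length [n, m, layers inst, alpha inst])
      (concat (map (\<lambda>k. block (pref_list inst (Suc k)) n) [0..<layers inst]))"
    unfolding list_at_append by blast
  then show ?thesis by (simp add: eval_nat_numeral)
qed

lemma memory_header:
  "memory 0 = n" "memory (Suc 0) = m" "memory 2 = layers inst" "memory 3 = alpha inst"
  by (simp_all add: input_state_def encode_def agents items eval_nat_numeral)

text \<open>An instance of \<open>list_at_funpow\<close> in which one step consists of
  \<open>n\<close> advances, one per agent.\<close>

lemma layer_memory:
  assumes "0 < n" "0 < m" "k < layers inst"
  shows "layer_memory memory n m (((advance memory ^^ n) ^^ k) 4) (pref_list inst (Suc k))"
proof
  show "list_at memory (((advance memory ^^ n) ^^ k) 4) (block (pref_list inst (Suc k)) n)"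
    using assms(3) funpow_advance_block
    by (intro list_at_funpow[OF list_at_memory]) auto
  show "set (pref_list inst (Suc k) a) \<subseteq> {..<m}" "distinct (pref_list inst (Suc k) a)" if "a < n" for a
    using pref_list(3,4)[OF _ that] assms(3) by auto
qed (use assms memory_header in auto)

lemma eval_optimal_layers:
  assumes "0 < n" "0 < m"
  shows "eval memory optimal_layers \<rho> =
    card {j \<in> {1..layers inst}. optimal_code n m (pref_list inst j) (\<rho> CodeP)}"
proof -
  have "eval memory optimal_layers \<rho> =
      (\<Sum>k<layers inst. of_bool (optimal_code n m (pref_list inst (Suc k)) (\<rho> CodeP)))"
    unfolding optimal_layers_def
    by (auto simp: memory_header layer_memory.eval_optimal[OF layer_memory[OF assms]] intro!: sum.cong)
  also have "\<dots> = (\<Sum>j\<in>{1..layers inst}. of_bool (optimal_code n m (pref_list inst j) (\<rho> CodeP)))"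
    by (rule sum.reindex_bij_witness[of _ "\<lambda>j. j - 1" Suc]) auto
  also have "\<dots> = card {j \<in> {1..layers inst}. optimal_code n m (pref_list inst j) (\<rho> CodeP)}"
    by (simp add: Int_def)
  finally show ?thesis .
qed

text \<open>Without agents or without items every assignment is \<open>None\<close> on all agents,
  so there is no strict improvement in any layer.\<close>

lemma goa_yes_trivial:
  assumes "n = 0 \<or> m = 0"
  shows "goa_yes inst"
proof -
  have none: "q a = None" if "assignment inst q" "a \<in> agents inst" for q a
    using assms that unfolding assignment_def agents items by auto
  have legal: "legal inst j (\<lambda>_. None)" for j by (simp add: legal_def assignment_def)
  have "\<not> prefers inst j a None (q a)" if "legal inst j q" "a \<in> agents inst" for j q a
    using none[of q a] that by (simp add: legal_def)
  then have "pareto_optimal inst j (\<lambda>_. None)" for j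
    using legal unfolding pareto_optimal_def by blast
  moreover have "alpha inst \<le> card {1..layers inst}" using inst by (simp add: goa_instance_def)
  then obtain J where "J \<subseteq> {1..layers inst}" "card J = alpha inst"
    by (meson obtain_subset_with_card_n)
  moreover have "assignment inst (\<lambda>_. None)" by (simp add: assignment_def)
  ultimately show ?thesis unfolding goa_yes_def globally_optimal_def by blast
qed

lemma eval_answer: "eval memory answer \<rho> = of_bool (goa_yes inst)"
proof (cases "n = 0 \<or> m = 0")
  case True
  then show ?thesis using goa_yes_trivial by (auto simp: answer_def memory_header)
next
  case False
  have "eval memory answer \<rho> = of_bool (0 < (\<Sum>v<(n + 1) ^ m.
      if card {j \<in> {1..layers inst}. optimal_code n m (pref_list inst j) v} < alpha inst
      then 0 else Suc 0))"
    using False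
    by (simp add: answer_def memory_header eval_optimal_layers cong: if_cong)
  then show ?thesis
    unfolding sum_if_less_pos_iff goa_yes_iff .
qed

section \<open>Running time\<close>

lemma cost_answer_trivial:
  assumes "n = 0 \<or> m = 0"
  shows "cost memory answer \<rho> \<le> 9"
  \<comment> \<open>Each test of \<open>n\<close> or \<open>m\<close> costs 4 and the final constant
    1: in total 5 or 9.\<close>
  using assms by (auto simp: answer_def memory_header)

text \<open>\<open>cost_le_power\<close> handles the parts without a loop over layers, whose weights
  \<open>w\<close> dominates. The loops over layers and candidates are bounded by
  \<open>cost_Sum_le\<close> and give the further factors \<open>layers inst\<close> and
  \<open>M\<close>.\<close>

lemma cost_answer:
  assumes pos: "0 < n" "0 < m"
  defines "w \<equiv> weight optimal + weight (skip num_agents) + weight (power_exp num_items)"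
  shows "cost memory answer \<rho> \<le> (w + 40) * (Suc n ^ m) ^ Suc w * layers inst"
proof -
  define M where "M = Suc n ^ m"
  define K where "K = M ^ w"
  have M: "1 \<le> M" by (simp add: M_def)
  then have K: "1 \<le> K" unfolding K_def by (rule one_le_power)
  have bound: "cost memory e \<rho> \<le> weight e * K" if "weight e \<le> w" "loops_le M memory e \<rho>"
    for e :: "var expr" and \<rho>
    unfolding K_def using le_mult_power_mono[OF cost_le_power[OF M that(2)] M that(1)] .
  have nm: "n \<le> M" "m \<le> M"
    using self_le_power[of "Suc n" m] less_exp[of m] power_mono[of 2 "Suc n" m] pos
    unfolding M_def by simp_all
  have power: "cost memory (power_exp num_items) \<rho> \<le> weight (power_exp num_items) * K" for \<rho>
    using nm by (intro bound) (simp_all add: w_def memory_header)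
  have layers: "cost memory optimal_layers \<rho> \<le>
      cost memory (Lit 4 :: var expr) \<rho> + cost memory num_layers \<rho> + 4 +
      eval memory num_layers \<rho> * (weight optimal * K + weight (skip num_agents) * K + 4)"
    if "\<rho> CodeP \<le> M" for \<rho>
    unfolding optimal_layers_def
  proof (intro cost_Sum_le add_mono bound)
    fix k assume "k < eval memory num_layers \<rho>"
    then have k: "k < layers inst" by (simp add: memory_header)
    show "loops_le M memory optimal (\<rho>(Layer :=
        ((\<lambda>v. eval memory (skip num_agents) (\<rho>(Layer := v))) ^^ k) (eval memory (Lit 4 :: var expr) \<rho>)))"
      unfolding M_def using that
      by (intro layer_memory.loops_le_optimal[OF layer_memory[OF pos k]]) (simp_all add: memory_header M_def)
  qed (use nm in \<open>simp_all add: w_def memory_header\<close>)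
  \<comment> \<open>The 15 is 7 for the overhead of the layer loop, 4 for the comparison with
    \<open>threshold\<close> and 4 for incrementing \<open>CodeP\<close>.\<close>
  let ?b = "layers inst * (weight optimal * K + weight (skip num_agents) * K + 4) + 15"
  define F where "F = For CodeP (power_exp num_items) (If_Less optimal_layers threshold (Lit 0) (Lit 1))"
  have "cost memory F \<rho> \<le>
      cost memory (Lit 0 :: var expr) \<rho> + cost memory (power_exp num_items) \<rho> + 4 +
      eval memory (power_exp num_items) \<rho> * (?b + 4)"
    unfolding F_def For_def
  proof (rule cost_Sum_le)
    fix k assume "k < eval memory (power_exp num_items) \<rho>"
    then have k: "k < M" by (simp add: memory_header M_def)
    have "((\<lambda>v. eval memory (Plus (Var CodeP) (Lit 1)) (\<rho>(CodeP := v))) ^^ k)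
      (eval memory (Lit 0 :: var expr) \<rho>) = k" by (simp add: funpow_Suc_0)
    moreover have "cost memory optimal_layers (\<rho>(CodeP := k)) \<le>
        layers inst * (weight optimal * K + weight (skip num_agents) * K + 4) + 7"
      using layers[of "\<rho>(CodeP := k)"] k by (simp add: memory_header)
    ultimately show "cost memory (If_Less optimal_layers threshold (Lit 0) (Lit 1)) (\<rho>(CodeP :=
        ((\<lambda>v. eval memory (Plus (Var CodeP) (Lit 1)) (\<rho>(CodeP := v))) ^^ k)
          (eval memory (Lit 0 :: var expr) \<rho>))) +
      cost memory (Plus (Var CodeP) (Lit 1)) (\<rho>(CodeP :=
        ((\<lambda>v. eval memory (Plus (Var CodeP) (Lit 1)) (\<rho>(CodeP := v))) ^^ k)
          (eval memory (Lit 0 :: var expr) \<rho>))) \<le> ?b"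
      by simp
  qed
  moreover have "eval memory (power_exp num_items) \<rho> = M"
    by (simp add: memory_header M_def)
  moreover have "cost memory answer \<rho> \<le> cost memory F \<rho> + 11"
    using pos unfolding answer_def F_def[symmetric] by (simp add: memory_header)
  ultimately have "cost memory answer \<rho> \<le> weight (power_exp num_items) * K + 16 +
      M * (layers inst * (weight optimal * K + weight (skip num_agents) * K + 4) + 19)"
    using power[of \<rho>] by (simp add: add.assoc del: eval_power_exp)
  \<comment> \<open>As \<open>K\<close>, \<open>M\<close> and \<open>layers inst\<close> are at
    least 1, every summand grows into a multiple of their product; the constants 16, 4 and 20 add up
    to 40.\<close>
  also have "\<dots> \<le> (weight (power_exp num_items) * K + 16 * K) * (M * layers inst) +
      M * ((layers inst * (weight optimal * K + weight (skip num_agents) * K + 4 * K)) + 20 * K * layers inst)"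
  proof (intro add_mono mult_le_mono order_refl)
    have l: "1 \<le> layers inst" using inst by (auto simp: goa_instance_def)
    then have "1 \<le> M * layers inst" using M by (simp add: Suc_le_eq)
    then show "19 \<le> 20 * K * layers inst"
      "weight (power_exp num_items) * K + 16 \<le> (weight (power_exp num_items) * K + 16 * K) * (M * layers inst)"
      using K l mult_le_mono[of 19 "20 * K" 1 "layers inst"]
        mult_le_mono[of "weight (power_exp num_items) * K + 16"
          "weight (power_exp num_items) * K + 16 * K" 1 "M * layers inst"] by simp_all
  qed (use K in simp_all)
  also have "\<dots> = (w + 40) * (M ^ Suc w) * layers inst"
    unfolding power_Suc K_def[symmetric] by (simp add: w_def algebra_simps)
  finally show ?thesis unfolding M_def .
qed

end

text \<open>If \<open>n * m \<ge> 2\<close>, then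
  \<open>n + 1 \<le> 2 * n \<le> (n * m) ^ 2\<close>. The factor 2 covers \<open>n = m = 1\<close>,
  where all powers of \<open>n * m\<close> are 1.\<close>

lemma power_le_power_mult:
  fixes n m :: nat
  assumes "0 < n" "0 < m"
  shows "Suc n ^ m \<le> 2 * (n * m) ^ (2 * m)"
proof (cases "n * m = 1")
  case True
  then show ?thesis by simp
next
  case False
  then have "2 \<le> n * m" using assms
    by (metis One_nat_def Suc_1 Suc_leI le_neq_implies_less nat_0_less_mult_iff)
  then have "2 * n \<le> (n * m) * (n * m)" using assms by (intro mult_le_mono) auto
  moreover have "Suc n \<le> 2 * n" using assms by simp
  ultimately have "Suc n \<le> (n * m) ^ 2" unfolding power2_eq_square by (rule order_trans[rotated])
  then have "Suc n ^ m \<le> ((n * m) ^ 2) ^ m" by (rule power_mono) simp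
  then show ?thesis by (simp add: power_mult)
qed

text \<open>\<open>max 1\<close> keeps the bound positive when agents or items are absent. The
  number of layers, unbounded in \<open>n\<close> and \<open>m\<close>, enters linearly.\<close>

theorem theorem4:
  "\<exists>prog c. \<forall>(inst :: (nat, nat) goa) n m.
     goa_instance inst \<longrightarrow> agents inst = {..<n} \<longrightarrow> items inst = {..<m} \<longrightarrow>
     answers_within prog (encode inst) (goa_yes inst)
       (c * max 1 (n * m) ^ (c * m) * layers inst)"
proof -
  \<comment> \<open>All variables initially share register 0, which contains 0, so evaluation starts
    in the constant environment 0. The result arrives in register 1 and is copied to register
    0.\<close>
  define prog where "prog = Seq (compile (\<lambda>_. 0) 1 answer) (Seq (Const 0 0) (Add 0 0 1))"
  define w where "w = weight optimal + weight (skip num_agents) + weight (power_exp num_items)"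
  \<comment> \<open>One constant acts as coefficient and in the exponent: the first summand is the
    coefficient left by \<open>(2 * (n * m) ^ (2 * m)) ^ Suc w\<close>, the second its factor in the
    exponent.\<close>
  define c where "c = (w + 50) * 2 ^ Suc w + 2 * Suc w"
  have "answers_within prog (encode inst) (goa_yes inst) (c * max 1 (n * m) ^ (c * m) * layers inst)"
    if "goa_instance inst" "agents inst = {..<n}" "items inst = {..<m}" for inst :: "(nat, nat) goa" and n m
  proof -
    interpret goa_numbered inst n m using that by unfold_locales
    have "implements (compile (\<lambda>_. 0) 1 answer) (\<lambda>_. 0) 1 memory answer"
      by (rule compile_correct) simp
    then obtain r where r: "exec (compile (\<lambda>_. 0) 1 answer) (\<lambda>_. 0, memory) (cost memory answer (\<lambda>_. 0)) (r, memory)"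
      "r 1 = eval memory answer (\<lambda>_. 0)"
      by (rule implementsD[of _ "\<lambda>_. 0" 1 memory answer "\<lambda>_. 0" "\<lambda>_. 0"]) auto
    have "exec prog (\<lambda>_. 0, memory) (cost memory answer (\<lambda>_. 0) + (1 + 1))
        ((r(0 := 0))(0 := (r(0 := 0)) 0 + (r(0 := 0)) 1), memory)"
      unfolding prog_def by (intro exec.Seq[OF r(1)] exec.Seq[OF exec.Const] exec.Add)
    moreover have "(\<lambda>_. 0, memory) = input_state (encode inst)" by (simp add: input_state_def)
    ultimately have run: "exec prog (input_state (encode inst)) (cost memory answer (\<lambda>_. 0) + (1 + 1))
        ((r(0 := 0))(0 := (r(0 := 0)) 0 + (r(0 := 0)) 1), memory)"
      by (rule back_subst[of "\<lambda>s. exec prog s _ _"])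
    have bound: "cost memory answer (\<lambda>_. 0) + (1 + 1) \<le> c * max 1 (n * m) ^ (c * m) * layers inst"
    proof (cases "n = 0 \<or> m = 0")
      case True
      have "50 * 1 \<le> (w + 50) * 2 ^ Suc w"
        by (rule mult_le_mono) (simp_all only: one_le_power le_add2 one_le_numeral)
      \<comment> \<open>9 steps for the trivial answer and 2 for copying the result.\<close>
      then have "11 \<le> c" unfolding c_def by linarith
      moreover have "1 \<le> layers inst" using that(1) by (auto simp: goa_instance_def)
      moreover have "max 1 (n * m) = 1" using True by auto
      ultimately show ?thesis
        using cost_answer_trivial[OF True, of "\<lambda>_. 0"] mult_le_mono[of 11 c 1 "layers inst"] by simp
    next
      case False
      then have pos: "0 < n" "0 < m" by auto
      then have M: "max 1 (n * m) = n * m" "1 \<le> n * m" by (auto simp: Suc_le_eq)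
      have "1 \<le> layers inst" using that(1) by (auto simp: goa_instance_def)
      \<comment> \<open>The product is at least 1, so the 2 copying steps fit between
        \<open>w + 40\<close> and \<open>w + 50\<close>.\<close>
      then have "1 * 1 \<le> (Suc n ^ m) ^ Suc w * layers inst"
        by (intro mult_le_mono one_le_power) simp_all
      moreover have "cost memory answer (\<lambda>_. 0) \<le> (w + 40) * (Suc n ^ m) ^ Suc w * layers inst"
        using cost_answer[OF pos] by (simp only: w_def)
      ultimately have "cost memory answer (\<lambda>_. 0) + 2 \<le>
          (w + 40) * (Suc n ^ m) ^ Suc w * layers inst + 10 * ((Suc n ^ m) ^ Suc w * layers inst)"
        by linarith
      also have "\<dots> = (w + 50) * (Suc n ^ m) ^ Suc w * layers inst"
        by (simp add: add_mult_distrib mult.assoc del: power_Suc)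
      also have "\<dots> \<le> (w + 50) * (2 * (n * m) ^ (2 * m)) ^ Suc w * layers inst"
        by (intro mult_le_mono order_refl power_mono power_le_power_mult[OF pos]) simp
      also have "\<dots> = ((w + 50) * 2 ^ Suc w) * (n * m) ^ (2 * Suc w * m) * layers inst"
        by (simp add: power_mult_distrib power_mult[symmetric] mult_ac del: power_Suc)
      also have "\<dots> \<le> c * (n * m) ^ (c * m) * layers inst"
        using M(2) by (intro mult_le_mono order_refl power_increasing) (simp_all add: c_def)
      finally show ?thesis unfolding M(1) by simp
    qed
    show ?thesis
      unfolding answers_within_def
      by (intro exI conjI, rule run, rule bound) (simp add: r(2)[simplified] eval_answer)
  qed
  then show ?thesis by blast
qed

end
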